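(* Let $N>K\ge1$, $0\le m\le K$, $n=K-m$, let $A=(a_1,\dots,a_m)\in\mathbb G_m$, and let $Z=(z_1,\dots,z_n)\in(\mathbb C\setminus\mathbb R)^n$ be an $n$-tuple of pairwise distinct numbers. Define a function $f_{A\mid Z,N,K}$ on $\mathbb G_K$ by: $f_{A\mid Z,N,K}(Y)=0$ if $Y\not\supseteq A$; and if $Y\supseteq A$, writing $Y\setminus A=(y_1,\dots,y_n)$, $$f_{A\mid Z,N,K}(Y)=\frac{\det\left[\dfrac1{(y_iz_j^{-1};q)_{N-K+1}}\right]_{i,j=1}^n}{V(y_1,\dots,y_n)\,V(z_1^{-1},\dots,z_n^{-1})\prod_{s=1}^n\prod_{r=1}^m(y_s-a_r)}.$$ Then for every $X\in\mathbb G_N$, $$\begin{aligned}(\Lambda^N_Kf_{A\mid Z,N,K})(X)={}&V(A)\prod_{i=1}^K\frac{(q;q)_{N-i}}{(q;q)_{K-i}(q;q)_{N-K}}\cdot\frac{(1-q^{N-K})^m|a_1|\cdots|a_m|}{(2\pi\sqrt{-1})^m}\prod_{x\in X}\prod_{s=1}^n\frac1{1-xz_s^{-1}}\\&\times\int_{C(a_1)}\cdots\int_{C(a_m)}V(w_1^{-1},\dots,w_m^{-1})\prod_{s=1}^n\prod_{r=1}^m(z_s^{-1}-w_r^{-1})\prod_{r=1}^m\frac{(a_rw_r^{-1}q;q)_{N-K-1}}{\prod_{x\in X}(1-xw_r^{-1})}\,\frac{dw_1}{w_1^2}\cdots\frac{dw_m}{w_m^2},\end{aligned}$$ where the variable $w_r$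 ranges over the contour $C(a_r)$, $1\le r\le m$.
   Context: Fix $q\in(0,1)$, $\zeta_+>0$, $\zeta_-<0$. Let $\mathfrak L=\{\zeta_+q^n:n\in\mathbb Z\}\cup\{\zeta_-q^n:n\in\mathbb Z\}\subset\mathbb R$. For $a<a'$ in $\mathfrak L$ set $I(a,a')=[a,a')\cap\mathfrak L$ if $a<a'<0$; $I(a,a')=[a,a']\cap\mathfrak L$ if $a<0<a'$; $I(a,a')=(a,a']\cap\mathfrak L$ if $0<a<a'$. For $M\ge1$, $\mathbb G_M$ is the set of $M$-point subsets $A=(a_1<\dots<a_M)$ of $\mathfrak L$; for $M=0$ it consists of the empty set. Write $|A|=|a_1|\cdots|a_M|$, $V(a_1,\dots,a_M)=\prod_{1\le i<j\le M}(a_i-a_j)$, $V(A)=V(a_1,\dots,a_M)$, and $|V(A)|$ for its absolute value. For $X=(x_1<\dots<x_{N+1})\in\mathbb G_{N+1}$ and $Y=(y_1<\dots<y_N)\in\mathbb G_N$ write $Y\prec X$ if $y_i\in I(x_i,x_{i+1})$ for $i=1,\dots,N$. Set $$\Lambda^{N+1}_N(X,Y)=(q;q)_N\,|Y|\,\frac{|V(Y)|}{|V(X)|}\ \text{ if } Y\prec X,\qquad \Lambda^{N+1}_N(X,Y)=0\ \text{ otherwise},$$ where $(a;q)_N=\prod_{i=0}^{N-1}(1-aq^i)$. This is a stochastic matrix of format $\mathbb G_{N+1}\times\mathbb G_N$. For $N>K\ge1$ put $\Lambda^N_K=\Lambda^N_{N-1}\cdots\Lambda^{K+1}_K$, a stochastic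 matrix of format $\mathbb G_N\times\mathbb G_K$. It acts on functions on $\mathbb G_K$ (bounded on bounded subsets) by $(\Lambda^N_Kf)(X)=\sum_{Y\in\mathbb G_K}\Lambda^N_K(X,Y)f(Y)$. For $y\in\mathfrak L$, $C(y)$ denotes a vertical line in $\mathbb C$ separating $y$ and $yq$, oriented from top to bottom: $C(y)=(a+\sqrt{-1}\,\infty,\;a-\sqrt{-1}\,\infty)$ with $a\in\mathbb R$ chosen arbitrarily strictly between $y$ and $yq$. Conventions: empty products, $V$ of the empty tuple, and $0\times0$ determinants equal $1$; for $m=0$ there is no integration and the last line equals $1$; for $m=K$ (so $n=0$) $f_{A\mid Z,N,K}$ is the delta function at $A$. The value $f_{A\mid Z,N,K}(Y)$ does not depend on the enumeration of $Y\setminus A$. *)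

theory Defs
  imports "HOL-Analysis.Analysis" "Jordan_Normal_Form.Determinant"
begin

definition qpoch :: "'a::comm_ring_1 \<Rightarrow> 'a \<Rightarrow> nat \<Rightarrow> 'a" where
  "qpoch a q n = (\<Prod>i<n. 1 - a * q ^ i)"

definition vandermonde :: "'a::comm_ring_1 list \<Rightarrow> 'a" where
  "vandermonde xs = (\<Prod>j<length xs. \<Prod>i<j. xs ! i - xs ! j)"

definition qlattice :: "real \<Rightarrow> real \<Rightarrow> real \<Rightarrow> real set" where
  "qlattice q zp zm = range (\<lambda>n::int. zp * q powi n) \<union> range (\<lambda>n::int. zm * q powi n)"

definition qinterval :: "real \<Rightarrow> real \<Rightarrow> real \<Rightarrow> real \<Rightarrow> real \<Rightarrow> real set" where
  "qinterval q zp zm a a' =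
     (if a' < 0 then {a..<a'} else if 0 < a then {a<..a'} else {a..a'}) \<inter> qlattice q zp zm"

definition configs :: "real \<Rightarrow> real \<Rightarrow> real \<Rightarrow> nat \<Rightarrow> real set set" where
  "configs q zp zm M = {A. A \<subseteq> qlattice q zp zm \<and> finite A \<and> card A = M}"

definition interlaces :: "real \<Rightarrow> real \<Rightarrow> real \<Rightarrow> real set \<Rightarrow> real set \<Rightarrow> bool" where
  "interlaces q zp zm Y X \<longleftrightarrow>
     (\<forall>i<card Y. sorted_list_of_set Y ! i
        \<in> qinterval q zp zm (sorted_list_of_set X ! i) (sorted_list_of_set X ! Suc i))"

text \<open>One-step matrix from level \<open>N + 1\<close> to level \<open>N\<close>; it is only meaningful for
  \<open>X \<in> configs q zp zm (N + 1)\<close> and \<open>Y \<in> configs q zp zm N\<close>.\<close>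

definition link1 :: "real \<Rightarrow> real \<Rightarrow> real \<Rightarrow> nat \<Rightarrow> real set \<Rightarrow> real set \<Rightarrow> real" where
  "link1 q zp zm N X Y =
     (if interlaces q zp zm Y X
      then qpoch q q N * (\<Prod>y\<in>Y. \<bar>y\<bar>)
             * (\<bar>vandermonde (sorted_list_of_set Y)\<bar> / \<bar>vandermonde (sorted_list_of_set X)\<bar>)
      else 0)"

text \<open>The matrix product leading from level \<open>N\<close> to level \<open>K\<close>; it is only meaningful for \<open>N > K\<close>.\<close>

primrec link :: "real \<Rightarrow> real \<Rightarrow> real \<Rightarrow> nat \<Rightarrow> nat \<Rightarrow> real set \<Rightarrow> real set \<Rightarrow> real" where
  "link q zp zm 0 K X Y = 0"
| "link q zp zm (Suc N) K X Y =
     (if N = K then link1 q zp zm K X Y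
      else (\<Sum>\<^sub>\<infinity>W\<in>configs q zp zm N. link1 q zp zm N X W * link q zp zm N K W Y))"

definition link_act ::
    "real \<Rightarrow> real \<Rightarrow> real \<Rightarrow> nat \<Rightarrow> nat \<Rightarrow> (real set \<Rightarrow> complex) \<Rightarrow> real set \<Rightarrow> complex" where
  "link_act q zp zm N K f X =
     (\<Sum>\<^sub>\<infinity>Y\<in>configs q zp zm K. complex_of_real (link q zp zm N K X Y) * f Y)"

text \<open>The function is symmetric in the points of \<open>Y - A\<close>, so they may be listed in increasing order.
  For \<open>Y\<close> at level \<open>K\<close> with \<open>A \<subseteq> Y\<close>, their number is the length of \<open>zs\<close> whenever
  \<open>card A + length zs = K\<close>.\<close>

definition f_AZ :: "real \<Rightarrow> real set \<Rightarrow> complex list \<Rightarrow> nat \<Rightarrow> nat \<Rightarrow> real set \<Rightarrow> complex" where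
  "f_AZ q A zs N K Y =
     (if A \<subseteq> Y then
        let ys = map complex_of_real (sorted_list_of_set (Y - A)); n = length zs in
          Determinant.det (mat n n (\<lambda>(i, j).
              1 / qpoch (ys ! i * inverse (zs ! j)) (complex_of_real q) (N - K + 1)))
          / (vandermonde ys * vandermonde (map inverse zs)
               * (\<Prod>s<n. \<Prod>a\<in>A. ys ! s - complex_of_real a))
      else 0)"

text \<open>Integral along the line \<open>Re w = c\<close> oriented from top to bottom, via \<open>w = c - \<i> t\<close>,
  \<open>dw = - \<i> dt\<close> with \<open>t\<close> running over the whole real line.\<close>

definition vline_integral :: "real \<Rightarrow> (complex \<Rightarrow> complex) \<Rightarrow> complex" where
  "vline_integral c f = (LBINT t. f (complex_of_real c - \<i> * complex_of_real t) * (- \<i>))"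

primrec iter_vline_integral :: "real list \<Rightarrow> (complex list \<Rightarrow> complex) \<Rightarrow> complex" where
  "iter_vline_integral [] f = f []"
| "iter_vline_integral (c # cs) f =
     vline_integral c (\<lambda>w. iter_vline_integral cs (\<lambda>ws. f (w # ws)))"

end

theory Submission
  imports Defs "HOL-Probability.Sinc_Integral" "HOL-Real_Asymp.Real_Asymp"
begin

text \<open>Functions of the form \<open>det [\<phi>\<^sub>j (y\<^sub>i)] / V(Y)\<close> are mapped by a link to functions of the same form: the
  sum over interlacing \<open>Y\<close> factorises over the intervals, each factor is a difference of values of a
  \<open>q\<close>-primitive of \<open>\<phi>\<^sub>j\<close>, and the determinant of differences is a determinant of size one larger with a
  column of ones added. The function in question has this form, with columns \<open>\<delta>\<^sub>a\<close> and
  \<open>1 / (y / z; q)\<close>, whose iterated \<open>q\<close>-primitives are explicit. After \<open>N - K\<close> steps the added columns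
  are the powers \<open>x\<^sup>j\<close> with \<open>j < N - K\<close>; eliminating them by Lagrange interpolation leaves a \<open>K \<times> K\<close>
  determinant whose entries are sums over \<open>x \<in> X\<close> of residues. For the columns coming from \<open>\<delta>\<^sub>a\<close> such a
  sum is the integral over \<open>C(a)\<close>, and expanding the Vandermonde determinant under the iterated
  integral gives the same \<open>K \<times> K\<close> determinant.\<close>

section \<open>Vandermonde determinants and Lagrange interpolation\<close>

text \<open>The kernel has index \<open>N - K + 1\<close> because every \<open>q\<close>-primitive
  removes one factor of its denominator: after \<open>N - K\<close> links a single factor
  \<open>1 - x / z\<close> is left, and partial fractions apply. A kernel column ends up divided by
  \<open>(q; q)\<close> of index \<open>N - K\<close>, a delta column only by that of index
  \<open>N - K - 1\<close>, since the first primitive of a delta is a plain step. The quotient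
  \<open>1 - q ^ (N - K)\<close> therefore enters once for each point of \<open>A\<close>. The
  denominator of the function is, up to sign, \<open>V(Y) / V(A)\<close> times \<open>V\<close> of
  the inverse \<open>z\<close>; the factors under the integral form, up to sign, the joint
  \<open>V\<close> of the inverse \<open>w\<close> and inverse \<open>z\<close>, divided by the
  latter. Hence both sides carry the same prefactor. The obstacle is analytic: the lattice
  accumulates at 0, so the sums are infinite and \<open>V(Y)\<close> has no positive lower bound on
  bounded configurations. Rearranging the sums needs a weight that every link reproduces up to a
  constant. No contour is deformed: on each line the integrand is rational with decay
  \<open>w ^ (-2)\<close>, and an explicit antiderivative yields the residues.\<close>

lemma det_mat_eq:
  "Determinant.det (mat n n f) = (\<Sum>p | p permutes {0..<n}. signof p * (\<Prod>i<n. f (i, p i)))"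
proof -
  have "(\<Prod>i = 0..<n. mat n n f $$ (i, p i)) = (\<Prod>i<n. f (i, p i))" if "p permutes {0..<n}" for p
    by (rule prod.cong) (use permutes_in_image[OF that] in \<open>auto simp: atLeast0LessThan\<close>)
  then show ?thesis
    by (simp add: det_def'[of _ n])
qed

lemma det_mat_unit_upper_triangular:
  assumes "\<And>i j. j < i \<Longrightarrow> i < n \<Longrightarrow> f (i, j) = 0" "\<And>i. i < n \<Longrightarrow> f (i, i) = 1"
  shows "Determinant.det (mat n n f) = 1"
proof -
  have "Determinant.det (mat n n f) = prod_list (diag_mat (mat n n f))"
    by (rule det_upper_triangular[of _ n]) (use assms in auto)
  also have "diag_mat (mat n n f) = map (\<lambda>i. 1) [0..<n]"
    using assms by (auto simp: diag_mat_def)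
  finally show ?thesis by (simp add: map_replicate_const)
qed

text \<open>The Newton polynomials \<open>P j\<close> are monic of degree \<open>j\<close>, so
  passing to them from the monomials is a unit upper triangular column operation. Since
  \<open>P j\<close> vanishes at \<open>x i\<close> for \<open>i < j\<close>, the new matrix is
  lower triangular.\<close>

lemma det_power_matrix:
  fixes x :: "nat \<Rightarrow> 'a :: field"
  shows "Determinant.det (mat n n (\<lambda>(i, j). x i ^ j)) = (\<Prod>j<n. \<Prod>i<j. x j - x i)"
proof -
  define P where "P j = (\<Prod>l<j. [:- x l, 1:])" for j
  have deg: "degree (P j) = j" for j
    by (simp add: P_def degree_prod_eq_sum_degree)
  have lc: "coeff (P j) j = 1" for j
    using lead_coeff_prod[of "\<lambda>l. [:- x l, 1:]" "{..<j}"] deg[of j] by (simp add: P_def)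
  let ?V = "mat n n (\<lambda>(i, j). x i ^ j)" and ?U = "mat n n (\<lambda>(k, j). coeff (P j) k)"
  have "Determinant.det ?U = 1"
    by (rule det_mat_unit_upper_triangular) (auto simp: lc deg coeff_eq_0)
  moreover have "?V * ?U = mat n n (\<lambda>(i, j). poly (P j) (x i))"
  proof (rule eq_matI)
    fix i j assume *: "i < dim_row (mat n n (\<lambda>(i, j). poly (P j) (x i)))" "j < dim_col (mat n n (\<lambda>(i, j). poly (P j) (x i)))"
    have "(\<Sum>k<n. x i ^ k * coeff (P j) k) = (\<Sum>k\<le>degree (P j). coeff (P j) k * x i ^ k)"
      using * by (intro sum.mono_neutral_cong_right) (auto simp: deg coeff_eq_0)
    then show "(?V * ?U) $$ (i, j) = mat n n (\<lambda>(i, j). poly (P j) (x i)) $$ (i, j)"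
      using * by (simp add: scalar_prod_def poly_altdef atLeast0LessThan)
  qed auto
  moreover have "Determinant.det (mat n n (\<lambda>(i, j). poly (P j) (x i))) = (\<Prod>j<n. \<Prod>i<j. x j - x i)"
  proof -
    have "Determinant.det (mat n n (\<lambda>(i, j). poly (P j) (x i))) = prod_list (diag_mat (mat n n (\<lambda>(i, j). poly (P j) (x i))))"
      by (rule det_lower_triangular[of n]) (auto simp: P_def poly_prod)
    also have "diag_mat (mat n n (\<lambda>(i, j). poly (P j) (x i))) = map (\<lambda>j. \<Prod>i<j. x j - x i) [0..<n]"
      by (auto simp: diag_mat_def P_def poly_prod)
    finally show ?thesis by (simp add: prod.list_conv_set_nth atLeast0LessThan)
  qed
  ultimately show ?thesis
    using det_mult[of ?V n ?U] by simp
qed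

text \<open>The sign \<open>(-1)\<^bsup>n(n-1)/2\<^esup>\<close> of the reversal of \<open>n\<close> points.\<close>

definition rev_sign :: "nat \<Rightarrow> 'a :: comm_ring_1" where
  "rev_sign n = (\<Prod>j<n. (-1) ^ j)"

lemma rev_sign_mult_self [simp]: "rev_sign n * rev_sign n = (1 :: 'a :: comm_ring_1)"
  by (simp add: rev_sign_def flip: prod.distrib power_mult_distrib)

lemma rev_sign_neq_0 [simp]: "rev_sign n \<noteq> (0 :: 'a :: idom)"
  by (simp add: rev_sign_def)

lemma of_real_rev_sign [simp]:
  "of_real (rev_sign n) = (rev_sign n :: 'a :: {comm_ring_1, real_algebra_1})"
  by (simp add: rev_sign_def)

lemma vandermonde_rev_sign:
  "vandermonde xs = rev_sign (length xs) * (\<Prod>j<length xs. \<Prod>i<j. xs ! j - xs ! i)"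
proof -
  have "(\<Prod>i<j. xs ! i - xs ! j) = (-1) ^ j * (\<Prod>i<j. xs ! j - xs ! i)" for j
  proof -
    have "(\<Prod>i<j. xs ! i - xs ! j) = (\<Prod>i<j. (-1) * (xs ! j - xs ! i))" by simp
    also have "\<dots> = (-1) ^ j * (\<Prod>i<j. xs ! j - xs ! i)"
      unfolding prod.distrib by (simp only: prod_constant card_lessThan)
    finally show ?thesis .
  qed
  then show ?thesis
    by (simp add: vandermonde_def rev_sign_def prod.distrib)
qed

lemma vandermonde_eq_det:
  fixes xs :: "'a :: field list"
  shows "vandermonde xs = rev_sign (length xs) *
           Determinant.det (mat (length xs) (length xs) (\<lambda>(i, j). xs ! i ^ j))"
  using det_power_matrix[of "length xs" "\<lambda>i. xs ! i"] by (simp add: vandermonde_rev_sign)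

lemma vandermonde_neq_0:
  fixes xs :: "'a :: idom list"
  shows "distinct xs \<Longrightarrow> vandermonde xs \<noteq> 0"
  by (auto simp: vandermonde_def nth_eq_iff_index_eq)

lemma prod_lessThan_add:
  fixes f :: "nat \<Rightarrow> 'a :: comm_monoid_mult"
  shows "prod f {..<m + n} = prod f {..<m} * (\<Prod>j<n. f (m + j))"
  by (induction n) (simp_all add: mult.assoc)

lemma vandermonde_append:
  "vandermonde (xs @ ys) = vandermonde xs * vandermonde ys *
     (\<Prod>s<length ys. \<Prod>r<length xs. xs ! r - ys ! s)"
proof -
  have "vandermonde (xs @ ys) =
      (\<Prod>j<length xs. \<Prod>i<j. (xs @ ys) ! i - (xs @ ys) ! j) *
      (\<Prod>j<length ys. \<Prod>i<length xs + j. (xs @ ys) ! i - (xs @ ys) ! (length xs + j))"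
    unfolding vandermonde_def length_append by (rule prod_lessThan_add)
  also have "(\<Prod>j<length xs. \<Prod>i<j. (xs @ ys) ! i - (xs @ ys) ! j) = vandermonde xs"
    by (simp add: vandermonde_def nth_append)
  also have "(\<Prod>j<length ys. \<Prod>i<length xs + j. (xs @ ys) ! i - (xs @ ys) ! (length xs + j)) =
      (\<Prod>j<length ys. (\<Prod>i<length xs. xs ! i - ys ! j) * (\<Prod>i<j. ys ! i - ys ! j))"
    by (simp add: prod_lessThan_add nth_append)
  finally show ?thesis
    by (simp add: prod.distrib vandermonde_def mult_ac)
qed

lemma vandermonde_map_of_real:
  "vandermonde (map of_real xs) = (of_real (vandermonde xs) :: 'a :: {comm_ring_1, real_algebra_1})"
  by (simp add: vandermonde_def)

lemma abs_vandermonde_sorted: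
  fixes xs :: "real list"
  assumes "sorted_wrt (<) xs"
  shows "\<bar>vandermonde xs\<bar> = (\<Prod>j<length xs. \<Prod>i<j. xs ! j - xs ! i)"
proof -
  have "(\<Prod>j<length xs. \<Prod>i<j. xs ! j - xs ! i) \<ge> 0"
    using sorted_wrt_nth_less[OF assms] by (intro prod_nonneg) (auto intro!: prod_nonneg less_imp_le)
  moreover have "\<bar>rev_sign n\<bar> = (1 :: real)" for n
    by (simp add: rev_sign_def abs_prod power_abs)
  ultimately show ?thesis
    by (simp add: vandermonde_rev_sign abs_mult)
qed

text \<open>Reconciles the absolute values in the links with the signed determinants: for increasing
  points only the sign of the reversal remains.\<close>

lemma vandermonde_sorted:
  fixes xs :: "real list"
  assumes "sorted_wrt (<) xs"
  shows "vandermonde xs = rev_sign (length xs) * \<bar>vandermonde xs\<bar>"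
  unfolding abs_vandermonde_sorted[OF assms] by (rule vandermonde_rev_sign)

section \<open>Lagrange interpolation and partial fractions at distinct nodes\<close>

context
  fixes x :: "nat \<Rightarrow> 'a :: field" and N :: nat
  assumes inj: "inj_on x {..<N}"
begin

abbreviation node_deriv :: "nat \<Rightarrow> 'a" where
  "node_deriv k \<equiv> (\<Prod>l\<in>{..<N} - {k}. x k - x l)"

lemma node_deriv_neq_0: "k < N \<Longrightarrow> node_deriv k \<noteq> 0"
  using inj by (auto simp: inj_on_def)

lemma lagrange_interpolation:
  assumes "degree p < N"
  shows "p = (\<Sum>k<N. Polynomial.smult (poly p (x k) / node_deriv k) (\<Prod>l\<in>{..<N} - {k}. [:- x l, 1:]))"
    (is "p = ?R")
proof (rule poly_eqI_degree[of "x ` {..<N}"])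
  have card: "card (x ` {..<N}) = N" using inj by (simp add: card_image)
  show "card (x ` {..<N}) > degree p" using assms card by simp
  have "degree (Polynomial.smult (poly p (x k) / node_deriv k) (\<Prod>l\<in>{..<N} - {k}. [:- x l, 1:])) \<le> N - 1"
    if "k < N" for k
    by (rule order.trans[OF degree_smult_le]) (use that in \<open>simp add: degree_prod_eq_sum_degree\<close>)
  then have "degree ?R \<le> N - 1" by (intro degree_sum_le) auto
  then show "card (x ` {..<N}) > degree ?R" using assms card by simp
next
  fix y assume "y \<in> x ` {..<N}"
  then obtain i where i: "i < N" "y = x i" by auto
  have "poly ?R (x i) = (\<Sum>k<N. poly p (x k) / node_deriv k * (\<Prod>l\<in>{..<N} - {k}. x i - x l))"
    by (simp add: poly_sum poly_prod)
  also have "\<dots> = (\<Sum>k<N. if k = i then poly p (x i) else 0)"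
    using i node_deriv_neq_0[of i] by (intro sum.cong) auto
  finally show "poly p y = poly ?R y" using i by simp
qed

text \<open>Compare the coefficients of degree \<open>N - 1\<close> in the interpolation formula. It
  serves as the relation that makes power columns triangular, and, for degree at most
  \<open>N - 2\<close>, as the vanishing of the sum of all residues of \<open>p\<close> over the
  product of the \<open>X - x k\<close>.\<close>

lemma sum_node_deriv:
  assumes "degree p < N"
  shows "(\<Sum>k<N. poly p (x k) / node_deriv k) = coeff p (N - 1)"
proof -
  have "coeff (\<Prod>l\<in>{..<N} - {k}. [:- x l, 1:]) (N - 1) = 1" if "k < N" for k
    using that lead_coeff_prod[of "\<lambda>l. [:- x l, 1:]" "{..<N} - {k}"]
    by (simp add: degree_prod_eq_sum_degree)
  then have "coeff (\<Sum>k<N. Polynomial.smult (poly p (x k) / node_deriv k) (\<Prod>l\<in>{..<N} - {k}. [:- x l, 1:])) (N - 1)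
      = (\<Sum>k<N. poly p (x k) / node_deriv k)"
    by (simp add: coeff_sum)
  then show ?thesis
    using lagrange_interpolation[OF assms] by simp
qed

lemma partial_fractions:
  assumes "degree p < N" "\<And>k. k < N \<Longrightarrow> t \<noteq> x k"
  shows "(\<Sum>k<N. poly p (x k) / node_deriv k / (t - x k)) = poly p t / (\<Prod>k<N. t - x k)"
proof -
  have "poly p t = (\<Sum>k<N. poly p (x k) / node_deriv k * (\<Prod>l\<in>{..<N} - {k}. t - x l))"
    by (subst lagrange_interpolation[OF assms(1)]) (simp add: poly_sum poly_prod)
  moreover have "(\<Prod>l\<in>{..<N} - {k}. t - x l) = (\<Prod>l<N. t - x l) / (t - x k)" if "k < N" for k
    using that assms(2)[of k] by (simp add: prod.remove[of "{..<N}" k])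
  ultimately have "poly p t = (\<Sum>k<N. poly p (x k) / node_deriv k / (t - x k)) * (\<Prod>l<N. t - x l)"
    by (simp add: sum_distrib_right)
  moreover have "(\<Prod>l<N. t - x l) \<noteq> 0" using assms(2) by auto
  ultimately show ?thesis by (simp add: field_simps)
qed

text \<open>Multiplying by the matrix \<open>x\<^sub>k\<^sup>N\<^sup>-\<^sup>1\<^sup>-\<^sup>i / node_deriv k\<close> makes the columns of powers unit upper
  triangular, by Lagrange interpolation.\<close>

lemma det_powers_append:
  assumes N: "N = M + K"
  shows "Determinant.det (mat N N (\<lambda>(k, j). if j < M then x k ^ j else \<psi> (j - M) k)) =
         Determinant.det (mat N N (\<lambda>(k, j). x k ^ j)) *
         Determinant.det (mat K K (\<lambda>(i, j). \<Sum>k<N. x k ^ (K - 1 - i) * \<psi> j k / node_deriv k))"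
    (is "Determinant.det ?A = Determinant.det ?V * Determinant.det ?C")
proof -
  let ?d = Determinant.det
  let ?W = "mat N N (\<lambda>(i, k). x k ^ (N - 1 - i) / node_deriv k)"
  have pw: "(\<Sum>k<N. x k ^ (N - 1 - i) / node_deriv k * x k ^ j) = (if i = j then 1 else 0)"
    if "j \<le> i" "i < N" for i j
  proof -
    have "(\<Sum>k<N. x k ^ (N - 1 - i) / node_deriv k * x k ^ j) =
        (\<Sum>k<N. poly (monom 1 (N - 1 - i + j)) (x k) / node_deriv k)"
      by (simp add: poly_monom power_add)
    also have "\<dots> = coeff (monom 1 (N - 1 - i + j)) (N - 1)"
      by (rule sum_node_deriv) (use that in \<open>simp add: degree_monom_eq\<close>)
    also have "\<dots> = (if i = j then 1 else 0)"
      using that by auto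
    finally show ?thesis .
  qed
  have mult: "?W * mat N N f = mat N N (\<lambda>(i, j). \<Sum>k<N. x k ^ (N - 1 - i) / node_deriv k * f (k, j))" for f
    by (rule eq_matI) (auto simp: scalar_prod_def atLeast0LessThan)
  have "?d (?W * ?V) = 1"
    unfolding mult by (rule det_mat_unit_upper_triangular) (use pw in auto)
  then have 1: "?d ?W * ?d ?V = 1"
    using det_mult[of ?W N ?V] by simp
  define U where "U = mat M M (\<lambda>(i, j). \<Sum>k<N. x k ^ (N - 1 - i) / node_deriv k * x k ^ j)"
  define B where "B = mat M K (\<lambda>(i, j). \<Sum>k<N. x k ^ (N - 1 - i) / node_deriv k * \<psi> j k)"
  \<comment> \<open>The power columns become unit triangular on top and zero below, so only the
    lower right block matters. Row \<open>M + i\<close> of \<open>?W\<close> has exponent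
    \<open>N - 1 - (M + i) = K - 1 - i\<close>, which gives the entries of
    \<open>?C\<close>.\<close>
  have "?W * ?A = four_block_mat U B (0\<^sub>m K M) ?C"
    unfolding mult
  proof (rule eq_matI)
    fix i j assume "i < dim_row (four_block_mat U B (0\<^sub>m K M) ?C)" "j < dim_col (four_block_mat U B (0\<^sub>m K M) ?C)"
    then have *: "i < N" "j < N" by (auto simp: U_def N)
    have "N - Suc i = K - Suc (i - M)" if "\<not> i < M" using that N by simp
    then show "mat N N (\<lambda>(i, j). \<Sum>k<N. x k ^ (N - 1 - i) / node_deriv k *
        (case (k, j) of (k, j) \<Rightarrow> if j < M then x k ^ j else \<psi> (j - M) k)) $$ (i, j)
        = four_block_mat U B (0\<^sub>m K M) ?C $$ (i, j)"
      using * N pw[of j i] by (auto simp: U_def B_def)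
  qed (auto simp: U_def N)
  moreover have "?d (four_block_mat U B (0\<^sub>m K M) ?C) = ?d U * ?d ?C"
    by (rule det_four_block_mat_lower_left_zero) (auto simp: U_def B_def)
  moreover have "?d U = 1"
    unfolding U_def by (rule det_mat_unit_upper_triangular) (use pw N in auto)
  ultimately have "?d ?W * ?d ?A = ?d ?C"
    using det_mult[of ?W N ?A] by simp
  then have "?d ?V * ?d ?W * ?d ?A = ?d ?V * ?d ?C" by simp
  with 1 show ?thesis by (simp add: mult.commute)
qed

end

section \<open>Sums over the lattice\<close>

lemma has_sum_mult_times:
  fixes f :: "'a \<Rightarrow> complex" and g :: "'b \<Rightarrow> complex"
  assumes "(f has_sum s) A" "(g has_sum t) B"
  shows "((\<lambda>(x, y). f x * g y) has_sum s * t) (A \<times> B)"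
proof (rule has_sum_SigmaI[where g = "\<lambda>x. f x * t"])
  have "(\<lambda>x. norm (f x)) summable_on A" "(\<lambda>y. norm (g y)) summable_on B"
    using assms by (auto simp: has_sum_imp_summable simp flip: summable_on_iff_abs_summable_on_complex)
  then show "(\<lambda>(x, y). f x * g y) summable_on A \<times> B"
    unfolding summable_on_iff_abs_summable_on_complex Infinite_Sum.abs_summable_on_Sigma_iff
    by (simp add: norm_mult abs_mult infsum_cmult_right' summable_on_cmult_right summable_on_cmult_left)
qed (use assms in \<open>auto intro: has_sum_cmult_right has_sum_cmult_left\<close>)

lemma has_sum_prod_PiE:
  fixes f :: "'a \<Rightarrow> 'b \<Rightarrow> complex"
  assumes "finite A" "\<And>i. i \<in> A \<Longrightarrow> (f i has_sum s i) (B i)"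
  shows "((\<lambda>g. \<Prod>i\<in>A. f i (g i)) has_sum (\<Prod>i\<in>A. s i)) (PiE A B)"
  using assms
proof (induction A rule: finite_induct)
  case empty
  show ?case by (simp add: has_sum_finiteI)
next
  case (insert x A)
  have "((\<lambda>(y, g). f x y * (\<Prod>i\<in>A. f i (g i))) has_sum s x * (\<Prod>i\<in>A. s i)) (B x \<times> PiE A B)"
    by (rule has_sum_mult_times) (use insert in auto)
  also have "?this \<longleftrightarrow> ((\<lambda>g. \<Prod>i\<in>insert x A. f i (g i)) \<circ> (\<lambda>(y, g). g(x := y)) has_sum s x * (\<Prod>i\<in>A. s i)) (B x \<times> PiE A B)"
  proof (intro has_sum_cong)
    fix p assume "p \<in> B x \<times> PiE A B"
    have "(\<Prod>i\<in>A. f i (if i = x then fst p else snd p i)) = (\<Prod>i\<in>A. f i (snd p i))"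
      using insert.hyps by (intro prod.cong) auto
    then show "(case p of (y, g) \<Rightarrow> f x y * (\<Prod>i\<in>A. f i (g i))) =
        ((\<lambda>g. \<Prod>i\<in>insert x A. f i (g i)) \<circ> (\<lambda>(y, g). g(x := y))) p"
      using insert.hyps by (simp add: case_prod_unfold)
  qed
  also have "\<dots> \<longleftrightarrow> ((\<lambda>g. \<Prod>i\<in>insert x A. f i (g i)) has_sum s x * (\<Prod>i\<in>A. s i)) (PiE (insert x A) B)"
    unfolding PiE_insert_eq using insert.hyps by (subst has_sum_reindex) (auto intro: inj_combinator)
  finally show ?case using insert.hyps by simp
qed

section \<open>The lattice, its rays and q-primitives\<close>

locale q_lattice =
  fixes q zp zm :: real
  assumes q_pos: "0 < q" and q_less_1: "q < 1" and zp_pos: "0 < zp" and zm_neg: "zm < 0"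
begin

abbreviation L :: "real set" where "L \<equiv> qlattice q zp zm"

lemma lattice_neq_0: "x \<in> L \<Longrightarrow> x \<noteq> 0"
  using q_pos zp_pos zm_neg by (auto simp: qlattice_def)

lemma lattice_mult_q:
  assumes "x \<in> L" shows "x * q ^ k \<in> L"
proof -
  have "z * q powi n * q ^ k = z * q powi (n + int k)" for z n
    using q_pos by (simp add: power_int_add)
  then show ?thesis using assms by (force simp: qlattice_def)
qed

lemma powi_le_imp:
  assumes "q powi j \<le> q powi i" shows "\<exists>k::nat. q powi j = q powi i * q ^ k"
proof -
  have "i \<le> j"
  proof (rule ccontr)
    assume "\<not> i \<le> j"
    then have "q powi i < q powi j"
      using q_pos q_less_1 by (intro power_int_strict_decreasing) auto
    then show False using assms by simp
  qed
  then have "q powi (j - i) = q ^ nat (j - i)" by (simp add: power_int_def)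
  then have "q powi j = q powi i * q ^ nat (j - i)"
    using q_pos power_int_add[of q i "j - i"] by simp
  then show ?thesis by (rule exI)
qed

text \<open>Lattice points of equal sign lie on one geometric progression, so the powers of
  \<open>q\<close> are ordered by modulus. The description by inequalities lets the interlacing
  intervals be written as differences or unions of rays.\<close>

lemma lattice_ray:
  assumes "x \<in> L"
  shows "range (\<lambda>k::nat. x * q ^ k) =
    {y \<in> L. (0 < x \<and> 0 < y \<and> y \<le> x) \<or> (x < 0 \<and> x \<le> y \<and> y < 0)}" (is "?A = ?B")
proof
  have "q ^ k \<le> 1" "q ^ k > 0" for k using q_pos q_less_1 by (auto simp: power_le_one)
  then show "?A \<subseteq> ?B"
    using lattice_mult_q[OF assms] lattice_neq_0[OF assms]
    by (auto simp: mult_le_cancel_left1 mult_le_cancel_left2 zero_less_mult_iff mult_less_0_iff)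
next
  show "?B \<subseteq> ?A"
  proof
    fix y assume y: "y \<in> ?B"
    have pos: "q powi i > 0" for i using q_pos by simp
    have "zp * q powi i > 0" "zm * q powi i < 0" for i
      using pos[of i] zp_pos zm_neg by (simp_all add: mult_neg_pos)
    note sgn = this this[THEN order.asym]
    have "\<exists>z i j. z \<noteq> 0 \<and> x = z * q powi i \<and> y = z * q powi j \<and> q powi j \<le> q powi i"
    proof (cases "x > 0")
      case True
      then obtain i j where ij: "x = zp * q powi i" "y = zp * q powi j"
        using y assms sgn unfolding qlattice_def by blast
      then have "q powi j \<le> q powi i" using True y zp_pos by simp
      with ij zp_pos show ?thesis by (intro exI[of _ zp] exI[of _ i] exI[of _ j]) auto
    next
      case False
      then obtain i j where ij: "x = zm * q powi i" "y = zm * q powi j"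
        using y assms sgn unfolding qlattice_def by blast
      then have "q powi j \<le> q powi i" using False y zm_neg by simp
      with ij zm_neg show ?thesis by (intro exI[of _ zm] exI[of _ i] exI[of _ j]) auto
    qed
    then obtain z i j where z: "x = z * q powi i" "y = z * q powi j" "q powi j \<le> q powi i"
      by blast
    obtain k :: nat where "q powi j = q powi i * q ^ k" using powi_le_imp[OF z(3)] by blast
    then have "y = x * q ^ k" using z by simp
    then show "y \<in> ?A" by blast
  qed
qed

text \<open>The point is the bound near 0, where the lattice accumulates: with the factor
  \<open>y\<close> it makes sums along a ray converge geometrically.\<close>

definition locally_bdd :: "(real \<Rightarrow> complex) \<Rightarrow> bool" where
  "locally_bdd \<phi> \<longleftrightarrow> (\<forall>R. \<exists>B. \<forall>y\<in>L. \<bar>y\<bar> \<le> R \<longrightarrow> norm (\<phi> y) \<le> B)"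

text \<open>Only differences of \<open>\<Phi>\<close> enter, so its limit at \<open>0\<close> is arbitrary; it must however be the same from
  both sides, because of the intervals containing \<open>0\<close>.\<close>

definition q_primitive :: "(real \<Rightarrow> complex) \<Rightarrow> (real \<Rightarrow> complex) \<Rightarrow> bool" where
  "q_primitive \<phi> \<Phi> \<longleftrightarrow> locally_bdd \<phi> \<and> (\<exists>l. (\<Phi> \<longlongrightarrow> l) (at 0)) \<and>
     (\<forall>x\<in>L. \<Phi> x - \<Phi> (x * q) = of_real x * \<phi> x)"

text \<open>Up to the factor \<open>1 - q\<close> this is the Jackson integral from 0 to
  \<open>x\<close>. The difference equation telescopes along the ray, the values of the primitive
  tend to \<open>l\<close>, and comparison with a geometric series makes the convergence
  absolute.\<close>

lemma q_primitive_ray: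
  assumes bdd: "locally_bdd \<phi>" and lim: "(\<Phi> \<longlongrightarrow> l) (at 0)"
    and eq: "\<And>x. x \<in> L \<Longrightarrow> \<Phi> x - \<Phi> (x * q) = of_real x * \<phi> x" and x: "x \<in> L"
  shows "((\<lambda>y. of_real y * \<phi> y) has_sum (\<Phi> x - l)) (range (\<lambda>k::nat. x * q ^ k))"
proof -
  have inj: "inj (\<lambda>k::nat. x * q ^ k)"
    using lattice_neq_0[OF x] q_pos q_less_1 by (auto intro!: injI simp: power_inject_exp')
  have "(\<lambda>k. x * q ^ k) \<longlonglongrightarrow> x * 0"
    using q_pos q_less_1 by (intro tendsto_mult LIMSEQ_power_zero) auto
  then have "filterlim (\<lambda>k. x * q ^ k) (at 0) sequentially"
    using lattice_neq_0[OF x] q_pos by (auto simp: filterlim_at)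
  then have "(\<lambda>k. \<Phi> (x * q ^ k)) \<longlonglongrightarrow> l"
    by (rule filterlim_compose[OF lim])
  from telescope_sums'[OF this]
  have sums: "(\<lambda>k. of_real (x * q ^ k) * \<phi> (x * q ^ k)) sums (\<Phi> x - l)"
    using eq[OF lattice_mult_q[OF x]] by (simp add: mult.assoc power_Suc2 del: power_Suc)
  obtain B where B: "\<And>y. y \<in> L \<Longrightarrow> \<bar>y\<bar> \<le> \<bar>x\<bar> \<Longrightarrow> norm (\<phi> y) \<le> B"
    using bdd unfolding locally_bdd_def by meson
  have "summable (\<lambda>k. norm (of_real (x * q ^ k) * \<phi> (x * q ^ k)))"
  proof (rule summable_comparison_test')
    show "summable (\<lambda>k. \<bar>x\<bar> * B * q ^ k)"
      using q_pos q_less_1 by (intro summable_mult summable_geometric) auto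
    fix k
    have "\<bar>x * q ^ k\<bar> \<le> \<bar>x\<bar>"
      using q_pos q_less_1 by (auto simp: abs_mult mult_left_le power_le_one)
    then have "norm (\<phi> (x * q ^ k)) \<le> B" using B lattice_mult_q[OF x] by blast
    then show "norm (norm (of_real (x * q ^ k) * \<phi> (x * q ^ k))) \<le> \<bar>x\<bar> * B * q ^ k"
      using q_pos mult_left_mono[of "norm (\<phi> (x * q ^ k))" B "\<bar>x\<bar> * q ^ k"]
      by (simp add: norm_mult norm_power mult_ac)
  qed
  then have "((\<lambda>k. of_real (x * q ^ k) * \<phi> (x * q ^ k)) has_sum (\<Phi> x - l)) UNIV"
    using sums by (rule norm_summable_imp_has_sum)
  then show ?thesis by (subst has_sum_reindex[OF inj]) (simp add: o_def)
qed

text \<open>The half-open conventions fit the rays: on the positive side the interval is the ray of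
  \<open>a'\<close> minus that of \<open>a\<close>, on the negative side the reverse, and across 0
  it is the union of both. The sign in \<open>\<bar>y\<bar>\<close> reverses the negative
  contributions, so \<open>l\<close> cancels and the answer has the same form in all three
  cases.\<close>

lemma has_sum_qinterval:
  assumes prim: "q_primitive \<phi> \<Phi>" and a: "a \<in> L" "a' \<in> L" "a < a'"
  shows "((\<lambda>y. of_real \<bar>y\<bar> * \<phi> y) has_sum (\<Phi> a' - \<Phi> a)) (qinterval q zp zm a a')"
proof -
  obtain l where l: "locally_bdd \<phi>" "(\<Phi> \<longlongrightarrow> l) (at 0)"
    "\<And>x. x \<in> L \<Longrightarrow> \<Phi> x - \<Phi> (x * q) = of_real x * \<phi> x"
    using prim unfolding q_primitive_def by blast
  let ?ray = "\<lambda>x. {y \<in> L. (0 < x \<and> 0 < y \<and> y \<le> x) \<or> (x < 0 \<and> x \<le> y \<and> y < 0)}"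
  have ray: "((\<lambda>y. of_real y * \<phi> y) has_sum (\<Phi> x - l)) (?ray x)" if "x \<in> L" for x
    using q_primitive_ray[OF l that] lattice_ray[OF that] by simp
  have pos: "((\<lambda>y. of_real \<bar>y\<bar> * \<phi> y) has_sum (\<Phi> x - l)) (?ray x)" if "x \<in> L" "x > 0" for x
    using ray[OF that(1)] by (rule has_sum_cong[THEN iffD1, rotated]) (use that in auto)
  have neg: "((\<lambda>y. of_real \<bar>y\<bar> * \<phi> y) has_sum (l - \<Phi> x)) (?ray x)" if "x \<in> L" "x < 0" for x
  proof -
    have "((\<lambda>y. - (of_real y * \<phi> y)) has_sum - (\<Phi> x - l)) (?ray x)"
      using ray[OF that(1)] by (simp add: has_sum_uminus)
    also have "?this \<longleftrightarrow> ?thesis" using that by (auto intro!: has_sum_cong)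
    finally show ?thesis .
  qed
  have "a \<noteq> 0" "a' \<noteq> 0" using a lattice_neq_0 by auto
  then consider "a' < 0" | "0 < a" | "a < 0" "0 < a'" using a(3) by linarith
  then show ?thesis
  proof cases
    case 1
    have "((\<lambda>y. of_real \<bar>y\<bar> * \<phi> y) has_sum (l - \<Phi> a) - (l - \<Phi> a')) (?ray a - ?ray a')"
      by (rule has_sum_Diff[OF neg neg]) (use 1 a in auto)
    also have "?ray a - ?ray a' = qinterval q zp zm a a'"
      using 1 a by (auto simp: qinterval_def)
    finally show ?thesis by simp
  next
    case 2
    have "((\<lambda>y. of_real \<bar>y\<bar> * \<phi> y) has_sum (\<Phi> a' - l) - (\<Phi> a - l)) (?ray a' - ?ray a)"
      by (rule has_sum_Diff[OF pos pos]) (use 2 a in auto)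
    also have "?ray a' - ?ray a = qinterval q zp zm a a'"
      using 2 a by (auto simp: qinterval_def)
    finally show ?thesis by simp
  next
    case 3
    have "((\<lambda>y. of_real \<bar>y\<bar> * \<phi> y) has_sum (l - \<Phi> a) + (\<Phi> a' - l)) (?ray a \<union> ?ray a')"
      by (rule has_sum_Un_disjoint[OF neg pos]) (use 3 a in auto)
    also have "?ray a \<union> ?ray a' = qinterval q zp zm a a'"
      using 3 a lattice_neq_0 by (force simp: qinterval_def)
    finally show ?thesis by simp
  qed
qed

end

section \<open>One link\<close>

lemma has_sum_sum:
  fixes f :: "'i \<Rightarrow> 'a \<Rightarrow> 'b :: topological_comm_monoid_add"
  assumes "finite I" "\<And>i. i \<in> I \<Longrightarrow> (f i has_sum s i) A"
  shows "((\<lambda>x. \<Sum>i\<in>I. f i x) has_sum (\<Sum>i\<in>I. s i)) A"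
  using assms by (induction I rule: finite_induct) (auto intro: has_sum_add)

text \<open>Subtracting from every row its predecessor is multiplication by the unit lower
  triangular \<open>?B\<close>. It turns the column of ones into the first unit vector and leaves
  the differences in the remaining block.\<close>

lemma det_differences:
  fixes G :: "nat \<Rightarrow> nat \<Rightarrow> 'a :: idom"
  shows "Determinant.det (mat (Suc n) (Suc n) (\<lambda>(i, j). if j = 0 then 1 else G (j - 1) i)) =
         Determinant.det (mat n n (\<lambda>(i, j). G j (Suc i) - G j i))"
    (is "Determinant.det ?A = Determinant.det ?D")
proof -
  let ?B = "mat (Suc n) (Suc n) (\<lambda>(i, k). if k = i then 1 else if Suc k = i then -1 else (0 :: 'a))"
  have sum: "(\<Sum>k<Suc n. (if k = i then 1 else if Suc k = i then -1 else 0) * f k) =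
      (if i = 0 then f 0 else f i - f (i - 1))" if "i < Suc n" for i and f :: "nat \<Rightarrow> 'a"
  proof -
    have "(\<Sum>k<Suc n. (if k = i then 1 else if Suc k = i then -1 else 0) * f k) =
        (\<Sum>k<Suc n. (if k = i then f k else 0) - (if i > 0 \<and> k = i - 1 then f k else 0))"
      by (intro sum.cong) auto
    also have "\<dots> = (if i = 0 then f 0 else f i - f (i - 1))"
      using that by (cases i) (simp_all add: sum_subtractf)
    finally show ?thesis .
  qed
  have "Determinant.det ?B = prod_list (diag_mat ?B)"
    by (rule det_lower_triangular[of "Suc n"]) auto
  also have "diag_mat ?B = map (\<lambda>i. 1) [0..<Suc n]"
    unfolding diag_mat_def by (rule map_cong) auto
  finally have "Determinant.det ?B = 1" by (simp add: map_replicate_const)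
  then have "Determinant.det ?A = Determinant.det (?B * ?A)"
    using det_mult[of ?B "Suc n" ?A] by simp
  also have "?B * ?A = four_block_mat (1\<^sub>m 1) (mat 1 n (\<lambda>(i, j). G j 0)) (0\<^sub>m n 1) ?D"
  proof (rule eq_matI)
    fix i j
    assume "i < dim_row (four_block_mat (1\<^sub>m 1) (mat 1 n (\<lambda>(i, j). G j 0)) (0\<^sub>m n 1) ?D)"
      "j < dim_col (four_block_mat (1\<^sub>m 1) (mat 1 n (\<lambda>(i, j). G j 0)) (0\<^sub>m n 1) ?D)"
    then have ij: "i < Suc n" "j < Suc n" by auto
    then have "(?B * ?A) $$ (i, j) = (\<Sum>k<Suc n. (if k = i then 1 else if Suc k = i then -1 else 0) *
        (if j = 0 then 1 else G (j - 1) k))"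
      unfolding lessThan_atLeast0
      by (subst times_mat_def) (auto simp: scalar_prod_def intro!: sum.cong)
    also have "\<dots> = four_block_mat (1\<^sub>m 1) (mat 1 n (\<lambda>(i, j). G j 0)) (0\<^sub>m n 1) ?D $$ (i, j)"
      unfolding sum[OF ij(1)] using ij by auto
    finally show "(?B * ?A) $$ (i, j) =
        four_block_mat (1\<^sub>m 1) (mat 1 n (\<lambda>(i, j). G j 0)) (0\<^sub>m n 1) ?D $$ (i, j)" .
  qed auto
  also have "Determinant.det \<dots> = Determinant.det (1\<^sub>m 1) * Determinant.det ?D"
    by (rule det_four_block_mat_lower_left_zero_col) auto
  finally show ?thesis by simp
qed

lemma sorted_list_of_set_image:
  fixes y :: "nat \<Rightarrow> 'a :: linorder"
  assumes "strict_mono_on {..<n} y"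
  shows "sorted_list_of_set (y ` {..<n}) = map y [0..<n]"
proof -
  have "sorted_wrt (<) (map y [0..<n])"
    using assms by (auto simp: sorted_wrt_iff_nth_less strict_mono_on_def)
  moreover have "card (y ` {..<n}) = n"
    using strict_mono_on_imp_inj_on[OF assms] by (simp add: card_image)
  ultimately show ?thesis
    by (intro sorted_list_of_set_unique[THEN iffD1]) (auto simp: atLeast0LessThan)
qed

context q_lattice
begin

abbreviation cf :: "nat \<Rightarrow> real set set" where "cf \<equiv> configs q zp zm"
abbreviation sl :: "real set \<Rightarrow> real list" where "sl \<equiv> sorted_list_of_set"

lemma config_list:
  assumes "X \<in> cf N"
  shows "length (sl X) = N" "set (sl X) = X" "sorted_wrt (<) (sl X)" "finite X" "X \<subseteq> L"
  using assms by (auto simp: configs_def)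

lemma config_nth:
  assumes "X \<in> cf N" "i < N"
  shows "sl X ! i \<in> X" "sl X ! i \<in> L"
  using assms config_list[OF assms(1)] nth_mem[of i "sl X"] by auto

lemma config_nth_less:
  assumes "X \<in> cf N" "i < j" "j < N"
  shows "sl X ! i < sl X ! j"
  using assms config_list[OF assms(1)] sorted_wrt_nth_less[of "(<)" "sl X"] by auto

lemma vandermonde_config_neq_0: "X \<in> cf N \<Longrightarrow> vandermonde (sl X) \<noteq> 0"
  by (simp add: vandermonde_neq_0)

definition box :: "nat \<Rightarrow> real set \<Rightarrow> (nat \<Rightarrow> real) set" where
  "box N X = (\<Pi>\<^sub>E i\<in>{..<N}. qinterval q zp zm (sl X ! i) (sl X ! Suc i))"

text \<open>Neighbouring intervals can meet only in the common endpoint. That endpoint is a nonzero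
  lattice point, and its sign decides which one of the two intervals contains it, so they are
  disjoint.\<close>

lemma box_strict_mono:
  assumes X: "X \<in> cf (Suc N)" and y: "y \<in> box N X"
  shows "strict_mono_on {..<N} y"
proof -
  have mem: "y i \<in> qinterval q zp zm (sl X ! i) (sl X ! Suc i)" if "i < N" for i
    using y that by (auto simp: box_def)
  have bd: "sl X ! i \<le> y i" "y i \<le> sl X ! Suc i" if "i < N" for i
    using mem[OF that] by (auto simp: qinterval_def split: if_splits)
  have step: "y i < y j" if "i < j" "j < N" for i j
  proof (cases "j = Suc i")
    case True
    have "sl X ! i < sl X ! Suc i" "sl X ! Suc i < sl X ! Suc (Suc i)"
      using True that by (auto intro!: config_nth_less[OF X])
    moreover have "sl X ! Suc i \<noteq> 0"
      using that by (intro lattice_neq_0 config_nth[OF X]) auto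
    ultimately show ?thesis
      using mem[of i] mem[of j] True that by (auto simp: qinterval_def split: if_splits)
  next
    case False
    then have "sl X ! Suc i < sl X ! j" using that by (intro config_nth_less[OF X]) auto
    then show ?thesis using bd[of i] bd[of j] that by simp
  qed
  then show ?thesis by (auto simp: strict_mono_on_def)
qed

text \<open>Turns a sum over interlacing sets into a sum over a product of intervals, where it
  factorises.\<close>

lemma bij_betw_box:
  assumes X: "X \<in> cf (Suc N)"
  shows "bij_betw (\<lambda>y. y ` {..<N}) (box N X) {Y \<in> cf N. interlaces q zp zm Y X}"
proof (rule bij_betw_byWitness[where f' = "\<lambda>Y. \<lambda>i\<in>{..<N}. sl Y ! i"])
  have sl: "sl (y ` {..<N}) = map y [0..<N]" if "y \<in> box N X" for y
    using sorted_list_of_set_image box_strict_mono[OF X that] by blast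
  show "\<forall>y\<in>box N X. (\<lambda>i\<in>{..<N}. sl (y ` {..<N}) ! i) = y"
    by (auto simp: sl box_def PiE_def extensional_def intro!: ext)
  show "\<forall>Y\<in>{Y \<in> cf N. interlaces q zp zm Y X}. (\<lambda>i\<in>{..<N}. sl Y ! i) ` {..<N} = Y"
  proof
    fix Y assume "Y \<in> {Y \<in> cf N. interlaces q zp zm Y X}"
    then have Y: "Y \<in> cf N" by simp
    have "(\<lambda>i\<in>{..<N}. sl Y ! i) ` {..<N} = (!) (sl Y) ` {..<N}" by auto
    also have "\<dots> = set (sl Y)" using config_list[OF Y] by (auto simp: set_conv_nth)
    also have "\<dots> = Y" using config_list[OF Y] by simp
    finally show "(\<lambda>i\<in>{..<N}. sl Y ! i) ` {..<N} = Y" .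
  qed
  show "(\<lambda>y. y ` {..<N}) ` box N X \<subseteq> {Y \<in> cf N. interlaces q zp zm Y X}"
  proof safe
    fix y assume y: "y \<in> box N X"
    have card: "card (y ` {..<N}) = N"
      using strict_mono_on_imp_inj_on[OF box_strict_mono[OF X y]] by (simp add: card_image)
    moreover have "y ` {..<N} \<subseteq> L"
      using y by (auto simp: box_def qinterval_def)
    ultimately show "y ` {..<N} \<in> cf N" by (auto simp: configs_def)
    show "interlaces q zp zm (y ` {..<N}) X"
      unfolding interlaces_def card sl[OF y] using y by (auto simp: box_def)
  qed
  show "(\<lambda>Y. \<lambda>i\<in>{..<N}. sl Y ! i) ` {Y \<in> cf N. interlaces q zp zm Y X} \<subseteq> box N X"
    unfolding box_def image_subset_iff restrict_PiE_iff by (auto simp: interlaces_def configs_def)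
qed

text \<open>The factor \<open>\<bar>V(Y)\<bar>\<close> of the link cancels against the denominator
  and \<open>\<bar>y\<bar>\<close> is distributed over the points. What remains is a product of
  one-variable sums, one for each interval.\<close>

lemma has_sum_link1_prod:
  assumes X: "X \<in> cf (Suc N)" and prim: "\<And>i. i < N \<Longrightarrow> q_primitive (\<phi> i) (\<Phi> i)"
  shows "((\<lambda>Y. of_real (link1 q zp zm N X Y) *
             ((\<Prod>i<N. \<phi> i (sl Y ! i)) / of_real \<bar>vandermonde (sl Y)\<bar>)) has_sum
          of_real (qpoch q q N) * ((\<Prod>i<N. \<Phi> i (sl X ! Suc i) - \<Phi> i (sl X ! i)) /
             of_real \<bar>vandermonde (sl X)\<bar>)) (cf N)"
    (is "(?f has_sum ?S) _")
proof -
  let ?c = "of_real (qpoch q q N) / of_real \<bar>vandermonde (sl X)\<bar> :: complex"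
  have "((\<lambda>y. \<Prod>i<N. of_real \<bar>y i\<bar> * \<phi> i (y i)) has_sum
      (\<Prod>i<N. \<Phi> i (sl X ! Suc i) - \<Phi> i (sl X ! i))) (box N X)"
    unfolding box_def
    by (rule has_sum_prod_PiE) (auto intro!: has_sum_qinterval prim config_nth(2)[OF X] config_nth_less[OF X])
  then have "((\<lambda>y. ?c * (\<Prod>i<N. of_real \<bar>y i\<bar> * \<phi> i (y i))) has_sum
      ?c * (\<Prod>i<N. \<Phi> i (sl X ! Suc i) - \<Phi> i (sl X ! i))) (box N X)"
    by (rule has_sum_cmult_right)
  also have "?c * (\<Prod>i<N. \<Phi> i (sl X ! Suc i) - \<Phi> i (sl X ! i)) = ?S" by simp
  also have "((\<lambda>y. ?c * (\<Prod>i<N. of_real \<bar>y i\<bar> * \<phi> i (y i))) has_sum ?S) (box N X) \<longleftrightarrow>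
      ((\<lambda>y. ?f (y ` {..<N})) has_sum ?S) (box N X)"
  proof (rule has_sum_cong)
    fix y assume y: "y \<in> box N X"
    have sl: "sl (y ` {..<N}) = map y [0..<N]"
      using sorted_list_of_set_image box_strict_mono[OF X y] by blast
    have inj: "inj_on y {..<N}"
      using strict_mono_on_imp_inj_on[OF box_strict_mono[OF X y]] .
    have Y: "y ` {..<N} \<in> cf N" "interlaces q zp zm (y ` {..<N}) X"
      using bij_betwE[OF bij_betw_box[OF X]] y by auto
    have "link1 q zp zm N X (y ` {..<N}) = qpoch q q N * (\<Prod>i<N. \<bar>y i\<bar>) *
        (\<bar>vandermonde (sl (y ` {..<N}))\<bar> / \<bar>vandermonde (sl X)\<bar>)"
      using Y(2) inj by (simp add: link1_def prod.reindex o_def)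
    moreover have "(\<Prod>i<N. \<phi> i (sl (y ` {..<N}) ! i)) = (\<Prod>i<N. \<phi> i (y i))"
      by (simp add: sl)
    ultimately show "?c * (\<Prod>i<N. of_real \<bar>y i\<bar> * \<phi> i (y i)) = ?f (y ` {..<N})"
      using vandermonde_config_neq_0[OF Y(1)] by (simp add: prod.distrib)
  qed
  also have "\<dots> \<longleftrightarrow> (?f has_sum ?S) {Y \<in> cf N. interlaces q zp zm Y X}"
    by (rule has_sum_reindex_bij_betw[OF bij_betw_box[OF X]])
  also have "\<dots> \<longleftrightarrow> (?f has_sum ?S) (cf N)"
    by (rule has_sum_cong_neutral) (auto simp: link1_def)
  finally show ?thesis .
qed

text \<open>The absolute value of \<open>V\<close> is used because it is what the links contain, so
  that no signs have to be tracked from level to level.\<close>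

definition det_ratio :: "nat \<Rightarrow> (nat \<Rightarrow> real \<Rightarrow> complex) \<Rightarrow> real set \<Rightarrow> complex" where
  "det_ratio N \<phi> Y =
     Determinant.det (mat N N (\<lambda>(i, j). \<phi> j (sl Y ! i))) / of_real \<bar>vandermonde (sl Y)\<bar>"

lemma has_sum_link1_det_ratio:
  assumes X: "X \<in> cf (Suc N)" and prim: "\<And>j. j < N \<Longrightarrow> q_primitive (\<phi> j) (\<Phi> j)"
  shows "((\<lambda>Y. of_real (link1 q zp zm N X Y) * det_ratio N \<phi> Y) has_sum
          of_real (qpoch q q N) * det_ratio (Suc N) (\<lambda>j. if j = 0 then \<lambda>_. 1 else \<Phi> (j - 1)) X) (cf N)"
proof -
  let ?P = "{p. p permutes {0..<N}}"
  have "((\<lambda>Y. \<Sum>p\<in>?P. signof p * (of_real (link1 q zp zm N X Y) *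
            ((\<Prod>i<N. \<phi> (p i) (sl Y ! i)) / of_real \<bar>vandermonde (sl Y)\<bar>))) has_sum
          (\<Sum>p\<in>?P. signof p * (of_real (qpoch q q N) *
            ((\<Prod>i<N. \<Phi> (p i) (sl X ! Suc i) - \<Phi> (p i) (sl X ! i)) /
             of_real \<bar>vandermonde (sl X)\<bar>)))) (cf N)"
  proof (intro has_sum_sum has_sum_cmult_right has_sum_link1_prod X prim)
    fix p i assume "p \<in> ?P" "i < N"
    then show "p i < N" using permutes_in_image[of p "{0..<N}" i] by simp
  qed (simp add: finite_permutations)
  also have "(\<lambda>Y. \<Sum>p\<in>?P. signof p * (of_real (link1 q zp zm N X Y) *
            ((\<Prod>i<N. \<phi> (p i) (sl Y ! i)) / of_real \<bar>vandermonde (sl Y)\<bar>))) =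
      (\<lambda>Y. of_real (link1 q zp zm N X Y) * det_ratio N \<phi> Y)"
    by (simp add: det_ratio_def det_mat_eq sum_distrib_left sum_divide_distrib mult_ac)
  also have "(\<Sum>p\<in>?P. signof p * (of_real (qpoch q q N) *
            ((\<Prod>i<N. \<Phi> (p i) (sl X ! Suc i) - \<Phi> (p i) (sl X ! i)) /
             of_real \<bar>vandermonde (sl X)\<bar>))) =
      of_real (qpoch q q N) * (Determinant.det (mat N N (\<lambda>(i, j). \<Phi> j (sl X ! Suc i) - \<Phi> j (sl X ! i))) /
         of_real \<bar>vandermonde (sl X)\<bar>)"
    by (simp add: det_mat_eq sum_distrib_left sum_divide_distrib mult_ac)
  also have "Determinant.det (mat N N (\<lambda>(i, j). \<Phi> j (sl X ! Suc i) - \<Phi> j (sl X ! i))) =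
      Determinant.det (mat (Suc N) (Suc N) (\<lambda>(i, j). (if j = 0 then \<lambda>_. 1 else \<Phi> (j - 1)) (sl X ! i)))"
    by (subst det_differences[of N "\<lambda>j i. \<Phi> j (sl X ! i)", symmetric])
      (auto intro!: arg_cong[where f = Determinant.det])
  finally show ?thesis by (simp only: det_ratio_def)
qed

end

section \<open>Composition of links\<close>

lemma infsum_complex_of_real:
  "(\<Sum>\<^sub>\<infinity>x\<in>A. complex_of_real (f x)) = complex_of_real (\<Sum>\<^sub>\<infinity>x\<in>A. f x)"
proof (rule infsum_bounded_linear_strong[OF _ bounded_linear_of_real])
  show "(\<lambda>x. complex_of_real (f x)) summable_on A \<longleftrightarrow> f summable_on A"
    by (rule summable_on_bounded_linear_iff[OF bounded_linear_of_real bounded_linear_Re]) simp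
qed

context q_lattice
begin

lemma qpoch_pos: "qpoch q q N > 0"
proof -
  have "q * q ^ i < 1" for i
    using q_pos q_less_1 power_Suc_less_one[of q i] by simp
  then show ?thesis by (auto simp: qpoch_def intro!: prod_pos)
qed

lemma link1_nonneg: "link1 q zp zm N X Y \<ge> 0"
  using qpoch_pos[of N] by (auto simp: link1_def intro!: mult_nonneg_nonneg prod_nonneg)

text \<open>Every point of \<open>Y\<close> lies between two points of \<open>X\<close>. Links thus
  preserve each window \<open>{-R..R}\<close>, and bounds on bounded sets are enough for
  summability.\<close>

lemma link1_support:
  assumes X: "X \<in> cf (Suc N)" "X \<subseteq> {-R..R}" and Y: "Y \<in> cf N" and nz: "link1 q zp zm N X Y \<noteq> 0"
  shows "Y \<subseteq> {-R..R}"
proof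
  fix y assume "y \<in> Y"
  then obtain i where i: "i < N" "y = sl Y ! i"
    using config_list[OF Y] by (metis in_set_conv_nth)
  have "interlaces q zp zm Y X" using nz by (simp add: link1_def split: if_splits)
  then have "y \<in> qinterval q zp zm (sl X ! i) (sl X ! Suc i)"
    using i Y by (auto simp: interlaces_def configs_def)
  then have "sl X ! i \<le> y" "y \<le> sl X ! Suc i" by (auto simp: qinterval_def split: if_splits)
  moreover have "sl X ! i \<in> X" "sl X ! Suc i \<in> X"
    using i by (auto intro!: config_nth[OF X(1)])
  ultimately show "y \<in> {-R..R}" using X(2) by fastforce
qed

definition inv_vdm :: "real set \<Rightarrow> real" where
  "inv_vdm Y = 1 / \<bar>vandermonde (sl Y)\<bar>"

lemma inv_vdm_nonneg: "inv_vdm Y \<ge> 0"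
  by (simp add: inv_vdm_def)

lemma q_primitive_1: "q_primitive (\<lambda>_. 1) (\<lambda>x. of_real (x / (1 - q)))"
  unfolding q_primitive_def
proof (intro conjI ballI exI)
  show "locally_bdd (\<lambda>_. 1)" by (auto simp: locally_bdd_def)
  show "((\<lambda>x. of_real (x / (1 - q))) \<longlongrightarrow> (of_real (0 / (1 - q)) :: complex)) (at 0)"
    by (intro tendsto_intros) (use q_less_1 in auto)
  fix x
  have "x / (1 - q) - x * q / (1 - q) = x * (1 - q) / (1 - q)"
    by (simp add: diff_divide_distrib right_diff_distrib)
  also have "\<dots> = x" using q_less_1 by simp
  finally show "of_real (x / (1 - q)) - of_real (x * q / (1 - q)) = (of_real x * 1 :: complex)"
    unfolding of_real_diff[symmetric] by simp
qed

text \<open>This is the product formula with all functions equal to 1: each interval contributes its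
  length divided by \<open>1 - q\<close>. The estimate returns the weight \<open>inv_vdm\<close> one
  level higher, so it can be iterated.\<close>

lemma link1_inv_vdm:
  assumes X: "X \<in> cf (Suc N)" and R: "X \<subseteq> {-R..R}"
  shows "(\<lambda>Y. link1 q zp zm N X Y * inv_vdm Y) summable_on cf N"
    and "(\<Sum>\<^sub>\<infinity>Y\<in>cf N. link1 q zp zm N X Y * inv_vdm Y) \<le> qpoch q q N * (2 * R / (1 - q)) ^ N * inv_vdm X"
proof -
  let ?s = "qpoch q q N * ((\<Prod>i<N. sl X ! Suc i / (1 - q) - sl X ! i / (1 - q)) / \<bar>vandermonde (sl X)\<bar>)"
  have "((\<lambda>Y. of_real (link1 q zp zm N X Y * inv_vdm Y) :: complex) has_sum of_real ?s) (cf N)"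
    using has_sum_link1_prod[OF X q_primitive_1] by (simp add: inv_vdm_def)
  then have *: "((\<lambda>Y. link1 q zp zm N X Y * inv_vdm Y) has_sum ?s) (cf N)"
    by (simp only: has_sum_of_real_iff)
  then show "(\<lambda>Y. link1 q zp zm N X Y * inv_vdm Y) summable_on cf N"
    by (rule has_sum_imp_summable)
  have "(\<Prod>i<N. sl X ! Suc i / (1 - q) - sl X ! i / (1 - q)) \<le> (\<Prod>i<N. 2 * R / (1 - q))"
  proof (rule prod_mono)
    fix i assume "i \<in> {..<N}"
    then have i: "sl X ! i < sl X ! Suc i" "sl X ! i \<in> X" "sl X ! Suc i \<in> X"
      by (auto intro!: config_nth_less[OF X] config_nth[OF X])
    moreover from i R have "-R \<le> sl X ! i" "sl X ! Suc i \<le> R" by (meson atLeastAtMost_iff subsetD)+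
    ultimately have "sl X ! Suc i - sl X ! i \<le> 2 * R" "sl X ! Suc i - sl X ! i \<ge> 0"
      by linarith+
    then show "0 \<le> sl X ! Suc i / (1 - q) - sl X ! i / (1 - q) \<and>
        sl X ! Suc i / (1 - q) - sl X ! i / (1 - q) \<le> 2 * R / (1 - q)"
      using q_less_1 by (simp add: divide_right_mono flip: diff_divide_distrib)
  qed
  then have "?s \<le> qpoch q q N * ((2 * R / (1 - q)) ^ N / \<bar>vandermonde (sl X)\<bar>)"
    using qpoch_pos[of N] by (intro mult_left_mono divide_right_mono) auto
  with * show "(\<Sum>\<^sub>\<infinity>Y\<in>cf N. link1 q zp zm N X Y * inv_vdm Y) \<le> qpoch q q N * (2 * R / (1 - q)) ^ N * inv_vdm X"
    by (simp add: infsumI inv_vdm_def)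
qed

text \<open>Absolute convergence is measured against \<open>1 / |V|\<close>, because the Vandermonde factors of consecutive
  links cancel; the function to be averaged need not be known to be bounded.\<close>

definition link_bounded :: "nat \<Rightarrow> nat \<Rightarrow> bool" where
  "link_bounded N K \<longleftrightarrow>
     (\<forall>X\<in>cf N. \<forall>Y\<in>cf K. link q zp zm N K X Y \<ge> 0) \<and>
     (\<forall>R. \<forall>X\<in>cf N. \<forall>Y\<in>cf K. X \<subseteq> {-R..R} \<longrightarrow> link q zp zm N K X Y \<noteq> 0 \<longrightarrow> Y \<subseteq> {-R..R}) \<and>
     (\<forall>X\<in>cf N. (\<lambda>Y. link q zp zm N K X Y * inv_vdm Y) summable_on cf K) \<and>
     (\<forall>R. \<exists>C. \<forall>X\<in>cf N. X \<subseteq> {-R..R} \<longrightarrow>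
        (\<Sum>\<^sub>\<infinity>Y\<in>cf K. link q zp zm N K X Y * inv_vdm Y) \<le> C * inv_vdm X)"

lemma finite_subset_Icc_real:
  fixes X :: "real set"
  assumes "finite X" shows "\<exists>R. X \<subseteq> {-R..R}"
proof -
  have "bounded X" using assms by (rule finite_imp_bounded)
  then obtain R where "\<And>x. x \<in> X \<Longrightarrow> norm x \<le> R" by (auto simp: bounded_iff)
  then have "X \<subseteq> {-R..R}" by (auto simp: abs_le_iff) (metis minus_le_iff)
  then show ?thesis by blast
qed

text \<open>All terms are nonnegative, so it suffices to bound the inner sum over \<open>Y\<close>
  by the weight at \<open>W\<close> and then to sum that weight against one link. The second claim
  quantifies over its own \<open>X\<close>: the constant has to be uniform on the window for the
  induction on levels.\<close>

lemma link_step_summable: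
  assumes lb: "link_bounded N K" and X: "X \<in> cf (Suc N)"
  defines "h \<equiv> \<lambda>(W, Y). link1 q zp zm N X W * link q zp zm N K W Y * inv_vdm Y"
  shows "h summable_on cf N \<times> cf K"
    and "\<And>R. \<exists>C. \<forall>X\<in>cf (Suc N). X \<subseteq> {-R..R} \<longrightarrow>
           (\<Sum>\<^sub>\<infinity>W\<in>cf N. \<Sum>\<^sub>\<infinity>Y\<in>cf K. link1 q zp zm N X W * link q zp zm N K W Y * inv_vdm Y) \<le> C * inv_vdm X"
proof -
  let ?S = "\<lambda>W. \<Sum>\<^sub>\<infinity>Y\<in>cf K. link q zp zm N K W Y * inv_vdm Y"
  have nonneg: "link q zp zm N K W Y \<ge> 0" if "W \<in> cf N" "Y \<in> cf K" for W Y
    using lb that by (auto simp: link_bounded_def)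
  have sumS: "(\<lambda>Y. link q zp zm N K W Y * inv_vdm Y) summable_on cf K" if "W \<in> cf N" for W
    using lb that by (auto simp: link_bounded_def)
  have S_nonneg: "?S W \<ge> 0" if "W \<in> cf N" for W
    using nonneg[OF that] by (intro infsum_nonneg mult_nonneg_nonneg inv_vdm_nonneg)
  have inner: "((\<lambda>Y. link1 q zp zm N X W * link q zp zm N K W Y * inv_vdm Y) has_sum
      link1 q zp zm N X W * ?S W) (cf K)" if "W \<in> cf N" for W X
    using has_sum_cmult_right[OF has_sum_infsum[OF sumS[OF that]]] by (simp add: mult.assoc)
  have bound: "\<exists>C. C \<ge> 0 \<and> (\<forall>X\<in>cf (Suc N). X \<subseteq> {-R..R} \<longrightarrow> (\<forall>W\<in>cf N.
      link1 q zp zm N X W * ?S W \<le> C * (link1 q zp zm N X W * inv_vdm W)))" for R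
  proof -
    obtain C where C: "\<And>W. W \<in> cf N \<Longrightarrow> W \<subseteq> {-R..R} \<Longrightarrow> ?S W \<le> C * inv_vdm W"
      using lb unfolding link_bounded_def by meson
    \<comment> \<open>The estimate of \<open>?S W\<close> is available only for \<open>W\<close>
      inside the window, and outside it the link is zero. The maximum with 0 makes the constant
      nonnegative, as is required when the summed estimate is scaled by it.\<close>
    have "link1 q zp zm N X W * ?S W \<le> max 0 C * (link1 q zp zm N X W * inv_vdm W)"
      if X: "X \<in> cf (Suc N)" "X \<subseteq> {-R..R}" and W: "W \<in> cf N" for X W
    proof (cases "link1 q zp zm N X W = 0")
      case False
      then have "?S W \<le> C * inv_vdm W" using C W link1_support[OF X W] by blast
      also have "\<dots> \<le> max 0 C * inv_vdm W" by (intro mult_right_mono inv_vdm_nonneg) auto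
      finally have "link1 q zp zm N X W * ?S W \<le> link1 q zp zm N X W * (max 0 C * inv_vdm W)"
        by (intro mult_left_mono link1_nonneg)
      then show ?thesis by (simp add: mult_ac)
    qed auto
    then show ?thesis by (intro exI[of _ "max 0 C"]) auto
  qed
  have outer: "(\<lambda>W. link1 q zp zm N X W * ?S W) summable_on cf N" if X: "X \<in> cf (Suc N)" for X
  proof -
    obtain R where R: "X \<subseteq> {-R..R}" using finite_subset_Icc_real config_list[OF X] by blast
    obtain C where "\<And>W. W \<in> cf N \<Longrightarrow> link1 q zp zm N X W * ?S W \<le> C * (link1 q zp zm N X W * inv_vdm W)"
      using bound[of R] X R by blast
    note C = this summable_on_cmult_right[OF link1_inv_vdm(1)[OF X R], of C]
    show ?thesis
    proof (rule summable_on_comparison_test[OF C(2)])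
      show "link1 q zp zm N X W * ?S W \<le> C * (link1 q zp zm N X W * inv_vdm W)" if "W \<in> cf N" for W
        by (rule C(1)[OF that])
      show "0 \<le> link1 q zp zm N X W * ?S W" if "W \<in> cf N" for W
        by (rule mult_nonneg_nonneg[OF link1_nonneg S_nonneg[OF that]])
    qed
  qed
  show "h summable_on cf N \<times> cf K"
    unfolding h_def
    by (rule summable_on_SigmaI[where g = "\<lambda>W. link1 q zp zm N X W * ?S W"])
      (use inner outer[OF X] nonneg in \<open>auto intro!: mult_nonneg_nonneg link1_nonneg inv_vdm_nonneg\<close>)
  fix R
  obtain C where C: "C \<ge> 0" "\<And>X W. X \<in> cf (Suc N) \<Longrightarrow> X \<subseteq> {-R..R} \<Longrightarrow> W \<in> cf N \<Longrightarrow>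
      link1 q zp zm N X W * ?S W \<le> C * (link1 q zp zm N X W * inv_vdm W)"
    using bound[of R] by blast
  have "(\<Sum>\<^sub>\<infinity>W\<in>cf N. \<Sum>\<^sub>\<infinity>Y\<in>cf K. link1 q zp zm N X W * link q zp zm N K W Y * inv_vdm Y)
      \<le> C * (qpoch q q N * (2 * R / (1 - q)) ^ N) * inv_vdm X"
    if X: "X \<in> cf (Suc N)" and R: "X \<subseteq> {-R..R}" for X
  proof -
    have "(\<Sum>\<^sub>\<infinity>W\<in>cf N. \<Sum>\<^sub>\<infinity>Y\<in>cf K. link1 q zp zm N X W * link q zp zm N K W Y * inv_vdm Y)
        = (\<Sum>\<^sub>\<infinity>W\<in>cf N. link1 q zp zm N X W * ?S W)"
      by (intro infsum_cong infsumI inner)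
    also have "\<dots> \<le> (\<Sum>\<^sub>\<infinity>W\<in>cf N. C * (link1 q zp zm N X W * inv_vdm W))"
      by (intro infsum_mono outer X summable_on_cmult_right link1_inv_vdm(1)[OF X R] C R)
    also have "\<dots> = C * (\<Sum>\<^sub>\<infinity>W\<in>cf N. link1 q zp zm N X W * inv_vdm W)"
      by (rule infsum_cmult_right')
    also have "\<dots> \<le> C * (qpoch q q N * (2 * R / (1 - q)) ^ N * inv_vdm X)"
      by (intro mult_left_mono link1_inv_vdm(2) X R C)
    finally show ?thesis by (simp add: mult_ac)
  qed
  then show "\<exists>C. \<forall>X\<in>cf (Suc N). X \<subseteq> {-R..R} \<longrightarrow>
      (\<Sum>\<^sub>\<infinity>W\<in>cf N. \<Sum>\<^sub>\<infinity>Y\<in>cf K. link1 q zp zm N X W * link q zp zm N K W Y * inv_vdm Y) \<le> C * inv_vdm X"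
    by blast
qed

lemma link_bounded_Suc:
  assumes lb: "link_bounded N K" and "N \<noteq> K"
  shows "link_bounded (Suc N) K"
proof -
  have link: "link q zp zm (Suc N) K X Y = (\<Sum>\<^sub>\<infinity>W\<in>cf N. link1 q zp zm N X W * link q zp zm N K W Y)" for X Y
    using \<open>N \<noteq> K\<close> by simp
  have nonneg: "link q zp zm N K W Y \<ge> 0" if "W \<in> cf N" "Y \<in> cf K" for W Y
    using lb that by (auto simp: link_bounded_def)
  have link_inv: "link q zp zm (Suc N) K X Y * inv_vdm Y =
      (\<Sum>\<^sub>\<infinity>W\<in>cf N. link1 q zp zm N X W * link q zp zm N K W Y * inv_vdm Y)" for X Y
    unfolding link by (rule infsum_cmult_left'[symmetric])
  have sm: "(\<lambda>(W, Y). link1 q zp zm N X W * link q zp zm N K W Y * inv_vdm Y) summable_on cf N \<times> cf K"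
    if "X \<in> cf (Suc N)" for X
    by (rule link_step_summable(1)[OF lb that])
  have 1: "link q zp zm (Suc N) K X Y \<ge> 0" if "Y \<in> cf K" for X Y
    unfolding link using that nonneg by (intro infsum_nonneg mult_nonneg_nonneg link1_nonneg) auto
  have 2: "Y \<subseteq> {-R..R}" if X: "X \<in> cf (Suc N)" "X \<subseteq> {-R..R}" and Y: "Y \<in> cf K"
    and nz: "link q zp zm (Suc N) K X Y \<noteq> 0" for X Y R
  proof -
    obtain W where W: "W \<in> cf N" "link1 q zp zm N X W * link q zp zm N K W Y \<noteq> 0"
      using nz unfolding link by (metis (mono_tags, lifting) infsum_0)
    then have "W \<subseteq> {-R..R}" using link1_support[OF X W(1)] by simp
    then show ?thesis using lb W Y unfolding link_bounded_def by (metis mult_zero_right)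
  qed
  have 3: "(\<lambda>Y. link q zp zm (Suc N) K X Y * inv_vdm Y) summable_on cf K" if X: "X \<in> cf (Suc N)" for X
    unfolding link_inv
    using summable_on_Sigma_banach[of "\<lambda>Y W. link1 q zp zm N X W * link q zp zm N K W Y * inv_vdm Y" "cf K" "\<lambda>_. cf N"]
      sm[OF X] summable_on_swap[of "\<lambda>(W, Y). link1 q zp zm N X W * link q zp zm N K W Y * inv_vdm Y" "cf N" "cf K"]
    by simp
  have "(\<Sum>\<^sub>\<infinity>Y\<in>cf K. link q zp zm (Suc N) K X Y * inv_vdm Y) =
      (\<Sum>\<^sub>\<infinity>W\<in>cf N. \<Sum>\<^sub>\<infinity>Y\<in>cf K. link1 q zp zm N X W * link q zp zm N K W Y * inv_vdm Y)"
    if X: "X \<in> cf (Suc N)" for X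
    unfolding link_inv by (rule infsum_swap_banach[OF sm[OF X], symmetric])
  then have 4: "\<exists>C. \<forall>X\<in>cf (Suc N). X \<subseteq> {-R..R} \<longrightarrow>
      (\<Sum>\<^sub>\<infinity>Y\<in>cf K. link q zp zm (Suc N) K X Y * inv_vdm Y) \<le> C * inv_vdm X" for R
  proof (cases "cf (Suc N) = {}")
    \<comment> \<open>The uniform estimate comes from a lemma with a fixed configuration among its
      assumptions, so a witness must exist; if there is none, the claim is vacuous.\<close>
    case False
    then obtain X where "X \<in> cf (Suc N)" by blast
    from link_step_summable(2)[OF lb this, of R]
    show ?thesis using \<open>\<And>X. X \<in> cf (Suc N) \<Longrightarrow> _ X = _ X\<close> by auto
  qed auto
  show ?thesis unfolding link_bounded_def using 1 2 3 4 by blast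
qed

lemma link_bounded: "K < N \<Longrightarrow> link_bounded N K"
proof (induction N)
  case (Suc N)
  show ?case
  proof (cases "N = K")
    case True
    have "(\<lambda>Y. link1 q zp zm K X Y * inv_vdm Y) summable_on cf K" if X: "X \<in> cf (Suc K)" for X
      using finite_subset_Icc_real config_list[OF X] link1_inv_vdm(1)[OF X] by blast
    moreover have "\<exists>C. \<forall>X\<in>cf (Suc K). X \<subseteq> {-R..R} \<longrightarrow>
        (\<Sum>\<^sub>\<infinity>Y\<in>cf K. link1 q zp zm K X Y * inv_vdm Y) \<le> C * inv_vdm X" for R
      using link1_inv_vdm(2)[of _ K R] by blast
    ultimately show ?thesis
      using True link1_nonneg link1_support[of _ K] by (simp add: link_bounded_def)
  next
    case False
    then show ?thesis using Suc by (intro link_bounded_Suc) auto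
  qed
qed auto

definition vdm_bounded :: "nat \<Rightarrow> (real set \<Rightarrow> complex) \<Rightarrow> bool" where
  "vdm_bounded K f \<longleftrightarrow> (\<forall>R. \<exists>B. \<forall>Y\<in>cf K. Y \<subseteq> {-R..R} \<longrightarrow> norm (f Y) \<le> B * inv_vdm Y)"

text \<open>Associativity of the matrix product when applied to a function, hence an exchange of two
  infinite sums. On the window of \<open>X\<close> the double family is dominated by
  \<open>B\<close> times the one of \<open>link_step_summable\<close>.\<close>

lemma link_act_Suc:
  assumes f: "vdm_bounded K f" and "K < N" and X: "X \<in> cf (Suc N)"
  shows "link_act q zp zm (Suc N) K f X =
    (\<Sum>\<^sub>\<infinity>W\<in>cf N. of_real (link1 q zp zm N X W) * link_act q zp zm N K f W)"
proof -
  have lb: "link_bounded N K" using link_bounded \<open>K < N\<close> .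
  have nonneg: "link q zp zm N K W Y \<ge> 0" if "W \<in> cf N" "Y \<in> cf K" for W Y
    using lb that by (auto simp: link_bounded_def)
  obtain R where R: "X \<subseteq> {-R..R}" using finite_subset_Icc_real config_list[OF X] by blast
  obtain B where B: "\<And>Y. Y \<in> cf K \<Longrightarrow> Y \<subseteq> {-R..R} \<Longrightarrow> norm (f Y) \<le> B * inv_vdm Y"
    using f unfolding vdm_bounded_def by meson
  let ?h = "\<lambda>(W, Y). of_real (link1 q zp zm N X W) * of_real (link q zp zm N K W Y) * f Y"
  have "norm (?h (W, Y)) \<le> B * (link1 q zp zm N X W * link q zp zm N K W Y * inv_vdm Y)"
    if WY: "W \<in> cf N" "Y \<in> cf K" for W Y
  proof (cases "link1 q zp zm N X W * link q zp zm N K W Y = 0")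
    case False
    then have "W \<subseteq> {-R..R}" using link1_support[OF X R WY(1)] by simp
    then have "Y \<subseteq> {-R..R}" using lb WY False unfolding link_bounded_def by (metis mult_zero_right)
    then have "norm (f Y) \<le> B * inv_vdm Y" using B WY by blast
    then have "link1 q zp zm N X W * link q zp zm N K W Y * norm (f Y) \<le>
        link1 q zp zm N X W * link q zp zm N K W Y * (B * inv_vdm Y)"
      using nonneg WY link1_nonneg by (intro mult_left_mono) auto
    then show ?thesis
      using nonneg WY link1_nonneg by (simp add: norm_mult abs_mult mult_ac)
  qed (auto simp: norm_mult abs_mult)
  note bd = this
  have "(\<lambda>p. norm (?h p)) summable_on cf N \<times> cf K"
  proof (rule summable_on_comparison_test[OF summable_on_cmult_right[OF link_step_summable(1)[OF lb X]]])
    show "norm (?h p) \<le> B * (case p of (W, Y) \<Rightarrow> link1 q zp zm N X W * link q zp zm N K W Y * inv_vdm Y)"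
      if "p \<in> cf N \<times> cf K" for p
      using that bd by (cases p) (simp add: mem_Times_iff)
  qed auto
  then have sm: "?h summable_on cf N \<times> cf K"
    by (simp add: summable_on_iff_abs_summable_on_complex)
  have "link_act q zp zm (Suc N) K f X =
      (\<Sum>\<^sub>\<infinity>Y\<in>cf K. of_real (\<Sum>\<^sub>\<infinity>W\<in>cf N. link1 q zp zm N X W * link q zp zm N K W Y) * f Y)"
    using \<open>K < N\<close> by (simp add: link_act_def)
  also have "\<dots> = (\<Sum>\<^sub>\<infinity>Y\<in>cf K. \<Sum>\<^sub>\<infinity>W\<in>cf N.
      of_real (link1 q zp zm N X W) * of_real (link q zp zm N K W Y) * f Y)"
    by (simp add: infsum_cmult_left' flip: infsum_complex_of_real)
  also have "\<dots> = (\<Sum>\<^sub>\<infinity>W\<in>cf N. \<Sum>\<^sub>\<infinity>Y\<in>cf K.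
      of_real (link1 q zp zm N X W) * of_real (link q zp zm N K W Y) * f Y)"
    by (rule infsum_swap_banach[OF sm, symmetric])
  also have "\<dots> = (\<Sum>\<^sub>\<infinity>W\<in>cf N. of_real (link1 q zp zm N X W) * link_act q zp zm N K f W)"
    by (simp add: link_act_def infsum_cmult_right' mult.assoc)
  finally show ?thesis .
qed

lemma vdm_bounded_det_ratio:
  assumes "\<And>j. j < K \<Longrightarrow> locally_bdd (\<phi> j)"
  shows "vdm_bounded K (det_ratio K \<phi>)"
  unfolding vdm_bounded_def
proof
  fix R
  have "\<forall>j\<in>{..<K}. \<exists>B. \<forall>y\<in>L. \<bar>y\<bar> \<le> R \<longrightarrow> norm (\<phi> j y) \<le> B"
    using assms by (auto simp: locally_bdd_def)
  then obtain B where B: "\<And>j y. j < K \<Longrightarrow> y \<in> L \<Longrightarrow> \<bar>y\<bar> \<le> R \<Longrightarrow> norm (\<phi> j y) \<le> B j"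
    by (metis lessThan_iff)
  let ?C = "\<Sum>p | p permutes {0..<K}. \<Prod>i<K. B (p i)"
  have "norm (det_ratio K \<phi> Y) \<le> ?C * inv_vdm Y" if Y: "Y \<in> cf K" "Y \<subseteq> {-R..R}" for Y
  proof -
    have "norm (signof p * (\<Prod>i<K. \<phi> (p i) (sl Y ! i))) \<le> (\<Prod>i<K. B (p i))"
      if p: "p permutes {0..<K}" for p
    proof -
      have "norm (\<Prod>i<K. \<phi> (p i) (sl Y ! i)) \<le> (\<Prod>i<K. B (p i))"
        unfolding prod_norm[symmetric]
      proof (intro prod_mono conjI norm_ge_zero B)
        fix i assume "i \<in> {..<K}"
        then show "p i < K" "sl Y ! i \<in> L" "\<bar>sl Y ! i\<bar> \<le> R"
          using permutes_in_image[OF p, of i] config_nth[OF Y(1), of i] Y(2) by (auto simp: abs_le_iff)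
      qed
      then show ?thesis by (simp add: norm_mult sign_def)
    qed
    then have "norm (Determinant.det (mat K K (\<lambda>(i, j). \<phi> j (sl Y ! i)))) \<le> ?C"
      unfolding det_mat_eq by (intro sum_norm_le) auto
    then show ?thesis
      by (simp add: det_ratio_def inv_vdm_def norm_divide divide_right_mono)
  qed
  then show "\<exists>B. \<forall>Y\<in>cf K. Y \<subseteq> {-R..R} \<longrightarrow> norm (det_ratio K \<phi> Y) \<le> B * inv_vdm Y"
    by blast
qed

text \<open>\<open>F k\<close> lists the columns at level \<open>K + k\<close>. Taking primitives
  raises the index by one, which frees index 0 for the new column of ones. The induction always
  splits off the topmost link, the one nearest to \<open>X\<close>.\<close>

theorem link_act_det_ratio:
  assumes prim: "\<And>k j. k < M \<Longrightarrow> j < K + k \<Longrightarrow> q_primitive (F k j) (F (Suc k) (Suc j))"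
    and one: "\<And>k. k < M \<Longrightarrow> F (Suc k) 0 = (\<lambda>_. 1)"
    and "0 < M" and "X \<in> cf (K + M)"
  shows "link_act q zp zm (K + M) K (det_ratio K (F 0)) X =
    of_real (\<Prod>l<M. qpoch q q (K + l)) * det_ratio (K + M) (F M) X"
proof -
  have f: "vdm_bounded K (det_ratio K (F 0))"
    using prim[of 0] \<open>0 < M\<close> by (intro vdm_bounded_det_ratio) (auto simp: q_primitive_def)
  have step: "((\<lambda>Y. of_real (link1 q zp zm (K + k) X Y) * det_ratio (K + k) (F k) Y) has_sum
      of_real (qpoch q q (K + k)) * det_ratio (Suc (K + k)) (F (Suc k)) X) (cf (K + k))"
    if "k < M" "X \<in> cf (Suc (K + k))" for k X
  proof -
    have "(\<lambda>j. if j = 0 then \<lambda>_. 1 else F (Suc k) (Suc (j - 1))) = F (Suc k)"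
      using one[OF that(1)] by (auto simp: fun_eq_iff)
    then show ?thesis
      using has_sum_link1_det_ratio[OF that(2), of "F k" "\<lambda>j. F (Suc k) (Suc j)"] prim[OF that(1)]
      by simp
  qed
  have "link_act q zp zm (K + Suc k) K (det_ratio K (F 0)) X =
      of_real (\<Prod>l<Suc k. qpoch q q (K + l)) * det_ratio (K + Suc k) (F (Suc k)) X"
    if "k < M" "X \<in> cf (K + Suc k)" for k X
    using that
  proof (induction k arbitrary: X)
    case 0
    then show ?case using step[of 0 X] by (simp add: link_act_def infsumI)
  next
    case (Suc k)
    have "link_act q zp zm (K + Suc (Suc k)) K (det_ratio K (F 0)) X =
        (\<Sum>\<^sub>\<infinity>W\<in>cf (K + Suc k). of_real (link1 q zp zm (K + Suc k) X W) *
           link_act q zp zm (K + Suc k) K (det_ratio K (F 0)) W)"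
      using link_act_Suc[OF f, of "K + Suc k" X] Suc.prems by simp
    also have "\<dots> = (\<Sum>\<^sub>\<infinity>W\<in>cf (K + Suc k). of_real (\<Prod>l<Suc k. qpoch q q (K + l)) *
        (of_real (link1 q zp zm (K + Suc k) X W) * det_ratio (K + Suc k) (F (Suc k)) W))"
      using Suc by (intro infsum_cong) (simp add: mult_ac)
    also have "\<dots> = of_real (\<Prod>l<Suc k. qpoch q q (K + l)) * (of_real (qpoch q q (K + Suc k)) *
        det_ratio (Suc (K + Suc k)) (F (Suc (Suc k))) X)"
      using Suc.prems by (intro infsumI has_sum_cmult_right step) auto
    finally show ?case by (simp add: mult_ac)
  qed
  from this[of "M - 1" X] show ?thesis using assms by simp
qed

end

section \<open>Integrals along vertical lines\<close>

text \<open>With \<open>w = c - \<i> * t\<close> and \<open>d = c - x\<close>, the first summand of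
  \<open>f\<close> is \<open>dw / (w - x)\<close>. Alone it decays only like \<open>1 / t\<close>;
  the second summand subtracts the kernel for \<open>d = 1\<close>, whose pole is on the side that
  contributes nothing. The downward line has the poles to its right, where \<open>d < 0\<close>, on
  its positive side.\<close>

lemma line_kernel:
  fixes d :: real
  assumes "d \<noteq> 0"
  defines "f \<equiv> \<lambda>t. - \<i> / (of_real d - \<i> * of_real t) + \<i> / (1 - \<i> * of_real t)"
  shows "integrable lborel f" and "(LBINT t. f t) = (if d < 0 then 2 * of_real pi * \<i> else 0)"
proof -
  have ne: "of_real d - \<i> * of_real t \<noteq> 0" "1 - \<i> * of_real t \<noteq> 0" for t
    using assms(1) by (auto simp: complex_eq_iff)
  have cont: "continuous_on UNIV f"
    unfolding f_def by (intro continuous_intros) (use ne in auto)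
  \<comment> \<open>Chosen so that
    \<open>m\<^sup>2 * (1 + t\<^sup>2) \<le> d\<^sup>2 + t\<^sup>2\<close>, which reduces the bound
    to the integrable function \<open>1 / (1 + t\<^sup>2)\<close>.\<close>
  define m where "m = min 1 \<bar>d\<bar>"
  have m: "0 < m" "m \<le> 1" "m \<le> \<bar>d\<bar>" using assms(1) by (auto simp: m_def)
  have int1: "integrable lborel (\<lambda>t::real. inverse (1 + t\<^sup>2))"
    using integrable_inverse_1_plus_square by (simp add: set_integrable_def)
  show int: "integrable lborel f"
  proof (rule Bochner_Integration.integrable_bound)
    show "integrable lborel (\<lambda>t. (1 + \<bar>d\<bar>) / m * inverse (1 + t\<^sup>2))"
      by (rule integrable_mult_right[OF int1])
    show "f \<in> borel_measurable lborel"
      using borel_measurable_continuous_onI[OF cont] by simp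
    show "AE t in lborel. norm (f t) \<le> norm ((1 + \<bar>d\<bar>) / m * inverse (1 + t\<^sup>2))"
    proof (rule AE_I2)
      fix t
      have "f t = \<i> * of_real (d - 1) / ((of_real d - \<i> * of_real t) * (1 - \<i> * of_real t))"
        unfolding f_def using ne[of t] by (simp add: divide_simps) (simp add: algebra_simps)
      moreover have "norm (of_real d - \<i> * of_real t) = sqrt (d\<^sup>2 + t\<^sup>2)"
        "norm (1 - \<i> * of_real t) = sqrt (1 + t\<^sup>2)"
        by (simp_all add: cmod_def)
      ultimately have "norm (f t) = \<bar>d - 1\<bar> / (sqrt (d\<^sup>2 + t\<^sup>2) * sqrt (1 + t\<^sup>2))"
        by (simp only: norm_mult norm_divide norm_of_real norm_ii mult_1)
      also have "\<dots> \<le> (1 + \<bar>d\<bar>) / ((m * sqrt (1 + t\<^sup>2)) * sqrt (1 + t\<^sup>2))"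
      proof (rule frac_le)
        have "m\<^sup>2 \<le> 1" "m\<^sup>2 \<le> d\<^sup>2" using m by (auto simp: abs_le_square_iff[symmetric] power_le_one)
        then have "m\<^sup>2 * (1 + t\<^sup>2) \<le> d\<^sup>2 + t\<^sup>2"
          using mult_right_mono[of "m\<^sup>2" 1 "t\<^sup>2"] by (simp add: algebra_simps)
        then have "sqrt (m\<^sup>2 * (1 + t\<^sup>2)) \<le> sqrt (d\<^sup>2 + t\<^sup>2)" by (rule real_sqrt_le_mono)
        then show "m * sqrt (1 + t\<^sup>2) * sqrt (1 + t\<^sup>2) \<le> sqrt (d\<^sup>2 + t\<^sup>2) * sqrt (1 + t\<^sup>2)"
          using m by (intro mult_right_mono) (auto simp: real_sqrt_mult)
        show "0 < m * sqrt (1 + t\<^sup>2) * sqrt (1 + t\<^sup>2)"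
          using m by (auto intro!: mult_pos_pos simp: add_pos_nonneg)
      qed auto
      also have "\<dots> = (1 + \<bar>d\<bar>) / m * inverse (1 + t\<^sup>2)"
        by (simp add: mult.assoc divide_simps)
      finally show "norm (f t) \<le> norm ((1 + \<bar>d\<bar>) / m * inverse (1 + t\<^sup>2))"
        using m by simp
    qed
  qed
  \<comment> \<open>Up to a constant this is \<open>log (d - \<i> * t) - log (1 - \<i> * t)\<close>.
    Writing the arguments with \<open>arctan\<close> keeps it smooth for \<open>d < 0\<close> too,
    where the principal logarithm would cross its cut at \<open>t = 0\<close>.\<close>
  define F where "F t = Complex (ln (d\<^sup>2 + t\<^sup>2) / 2 - ln (1 + t\<^sup>2) / 2) (arctan t - arctan (t / d))" for t
  have Re_f: "Re (f t) = t / (d\<^sup>2 + t\<^sup>2) - t / (1 + t\<^sup>2)"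
    and Im_f: "Im (f t) = 1 / (1 + t\<^sup>2) - d / (d\<^sup>2 + t\<^sup>2)" for t
    by (simp_all add: f_def Re_divide Im_divide)
  have arctan: "((\<lambda>t. arctan (t / d)) has_real_derivative d / (d\<^sup>2 + t\<^sup>2)) (at t)" if "d \<noteq> 0" for d t :: real
  proof -
    have "((\<lambda>t. arctan (t / d)) has_real_derivative inverse (1 + (t / d)\<^sup>2) * (1 / d)) (at t)"
      using that by (auto intro!: derivative_eq_intros)
    also have "1 + (t / d)\<^sup>2 = (d\<^sup>2 + t\<^sup>2) / d\<^sup>2"
      using that by (simp add: power_divide add_divide_distrib)
    also have "inverse \<dots> * (1 / d) = d / (d\<^sup>2 + t\<^sup>2)"
      using that by (simp add: power2_eq_square)
    finally show ?thesis .
  qed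
  have ln: "((\<lambda>t. ln (d\<^sup>2 + t\<^sup>2) / 2) has_real_derivative t / (d\<^sup>2 + t\<^sup>2)) (at t)" if "d \<noteq> 0" for d t :: real
  proof -
    have "0 < d\<^sup>2 + t\<^sup>2" using that by (auto intro: add_pos_nonneg)
    then show ?thesis
      by (auto intro!: derivative_eq_intros) (simp add: divide_simps algebra_simps)
  qed
  have "(F has_vector_derivative f t) (at t)" for t
    unfolding has_vector_derivative_complex_iff Re_f Im_f F_def complex.sel
    using DERIV_diff[OF ln[OF assms(1)] ln[of 1]] DERIV_diff[OF arctan[of 1] arctan[OF assms(1)]]
    by simp
  moreover have "(F \<longlongrightarrow> Complex 0 (pi / 2 - sgn d * (pi / 2))) at_top"
  proof -
    have "((\<lambda>t. ln (d\<^sup>2 + t\<^sup>2) / 2 - ln (1 + t\<^sup>2) / 2) \<longlongrightarrow> 0) at_top"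
      by real_asymp
    moreover have "((\<lambda>t. arctan t - arctan (t / d)) \<longlongrightarrow> pi / 2 - sgn d * (pi / 2)) at_top"
    proof (cases "d > 0")
      case True then show ?thesis by simp real_asymp
    next
      case False
      then have "d < 0" using assms(1) by simp
      then show ?thesis by simp real_asymp
    qed
    ultimately show ?thesis unfolding F_def by (rule tendsto_Complex)
  qed
  moreover have "(F \<longlongrightarrow> Complex 0 (- pi / 2 + sgn d * (pi / 2))) at_bot"
  proof -
    have "((\<lambda>t. ln (d\<^sup>2 + t\<^sup>2) / 2 - ln (1 + t\<^sup>2) / 2) \<longlongrightarrow> 0) at_bot"
      by real_asymp
    moreover have "((\<lambda>t. arctan t - arctan (t / d)) \<longlongrightarrow> - pi / 2 + sgn d * (pi / 2)) at_bot"
    proof (cases "d > 0")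
      case True then show ?thesis by simp real_asymp
    next
      case False
      then have "d < 0" using assms(1) by simp
      then show ?thesis by simp real_asymp
    qed
    ultimately show ?thesis unfolding F_def by (rule tendsto_Complex)
  qed
  ultimately have "(LBINT t=-\<infinity>..\<infinity>. f t) =
      Complex 0 (pi / 2 - sgn d * (pi / 2)) - Complex 0 (- pi / 2 + sgn d * (pi / 2))"
    using cont int
    by (intro interval_integral_FTC_integrable[where F = F])
      (auto simp: ereal_tendsto_simps continuous_on_eq_continuous_at set_integrable_def)
  also have "(LBINT t=-\<infinity>..\<infinity>. f t) = (LBINT t. f t)"
    by (simp add: interval_lebesgue_integral_def set_lebesgue_integral_def)
  also have "Complex 0 (pi / 2 - sgn d * (pi / 2)) - Complex 0 (- pi / 2 + sgn d * (pi / 2)) =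
      (if d < 0 then 2 * of_real pi * \<i> else 0)"
    using assms(1) by (auto simp: complex_eq_iff sgn_if)
  finally show "(LBINT t. f t) = (if d < 0 then 2 * of_real pi * \<i> else 0)" .
qed

definition vline_integrable :: "real \<Rightarrow> (complex \<Rightarrow> complex) \<Rightarrow> bool" where
  "vline_integrable c f \<longleftrightarrow> integrable lborel (\<lambda>t. f (of_real c - \<i> * of_real t) * (- \<i>))"

lemma vline_integral_cong:
  "(\<And>w. Re w = c \<Longrightarrow> f w = g w) \<Longrightarrow> vline_integral c f = vline_integral c g"
  by (simp add: vline_integral_def)

lemma vline_integrable_cong:
  "(\<And>w. Re w = c \<Longrightarrow> f w = g w) \<Longrightarrow> vline_integrable c f \<longleftrightarrow> vline_integrable c g"
  by (simp add: vline_integrable_def)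

lemma vline_integral_partial_fractions:
  fixes x :: "nat \<Rightarrow> real"
  assumes "\<And>k. k < N \<Longrightarrow> x k \<noteq> c" and "(\<Sum>k<N. C k) = 0"
  defines "f \<equiv> \<lambda>w. \<Sum>k<N. C k / (w - of_real (x k))"
  shows "vline_integrable c f"
    and "vline_integral c f = 2 * of_real pi * \<i> * (\<Sum>k | k < N \<and> c < x k. C k)"
proof -
  let ?g = "\<lambda>k t. - \<i> / (of_real (c - x k) - \<i> * of_real t) + \<i> / (1 - \<i> * of_real t)"
  \<comment> \<open>since the \<open>C k\<close> sum to zero, the same kernel may be subtracted from each summand, which makes
    the summands integrable\<close>
  have eq: "f (of_real c - \<i> * of_real t) * (- \<i>) = (\<Sum>k<N. C k * ?g k t)" for t
  proof -
    have "(\<Sum>k<N. C k * ?g k t) = (\<Sum>k<N. C k * (- \<i> / (of_real (c - x k) - \<i> * of_real t))) +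
        (\<Sum>k<N. C k) * (\<i> / (1 - \<i> * of_real t))"
      by (simp only: distrib_left sum.distrib sum_distrib_right)
    also have "\<dots> = f (of_real c - \<i> * of_real t) * (- \<i>)"
      unfolding assms(2) f_def sum_distrib_right
      by (simp, intro sum.cong) (auto simp: algebra_simps)
    finally show ?thesis by simp
  qed
  have int: "integrable lborel (\<lambda>t. C k * ?g k t)" if "k < N" for k
    using assms(1)[OF that] by (intro integrable_mult_right line_kernel) auto
  then show "vline_integrable c f"
    unfolding vline_integrable_def eq by (intro Bochner_Integration.integrable_sum) auto
  have "vline_integral c f = (\<Sum>k<N. LBINT t. C k * ?g k t)"
    unfolding vline_integral_def eq by (rule Bochner_Integration.integral_sum) (use int in auto)
  also have "\<dots> = (\<Sum>k<N. C k * (LBINT t. ?g k t))" by simp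
  also have "\<dots> = (\<Sum>k<N. C k * (if c - x k < 0 then 2 * of_real pi * \<i> else 0))"
    by (intro sum.cong arg_cong2[where f = "(*)"] refl line_kernel(2)) (use assms(1) in auto)
  also have "\<dots> = (\<Sum>k\<in>{..<N} \<inter> {k. c < x k}. C k * (2 * of_real pi * \<i>))"
    unfolding sum.inter_restrict[OF finite_lessThan] by (intro sum.cong) auto
  also have "{..<N} \<inter> {k. c < x k} = {k. k < N \<and> c < x k}" by auto
  finally show "vline_integral c f = 2 * of_real pi * \<i> * (\<Sum>k | k < N \<and> c < x k. C k)"
    by (simp add: sum_distrib_left mult_ac)
qed

text \<open>The residue theorem for simple real poles. The degree gap of at least two gives decay at
  infinity, and by \<open>sum_node_deriv\<close> it makes the residues sum to zero, which is exactly
  what the partial fraction version asks for.\<close>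

lemma vline_integral_rational:
  fixes x :: "nat \<Rightarrow> real" and p :: "complex poly"
  assumes inj: "inj_on x {..<N}" and c: "\<And>k. k < N \<Longrightarrow> x k \<noteq> c" and deg: "degree p + 1 < N"
  defines "f \<equiv> \<lambda>w. poly p w / (\<Prod>k<N. w - of_real (x k))"
    and "D \<equiv> \<lambda>k. \<Prod>l\<in>{..<N} - {k}. of_real (x k) - of_real (x l)"
  shows "vline_integrable c f"
    and "vline_integral c f = 2 * of_real pi * \<i> * (\<Sum>k | k < N \<and> c < x k. poly p (of_real (x k)) / D k)"
proof -
  have inj': "inj_on (\<lambda>k. complex_of_real (x k)) {..<N}"
    using inj by (simp add: inj_on_def)
  have eq: "f w = (\<Sum>k<N. poly p (of_real (x k)) / D k / (w - of_real (x k)))" if "Re w = c" for w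
    unfolding f_def D_def
  proof (intro partial_fractions[OF inj', symmetric])
    show "w \<noteq> of_real (x k)" if "k < N" for k
      using c[OF that] \<open>Re w = c\<close> by auto
  qed (use deg in simp)
  have 0: "(\<Sum>k<N. poly p (of_real (x k)) / D k) = 0"
    unfolding D_def using sum_node_deriv[OF inj', of p] deg by (simp add: coeff_eq_0)
  have "vline_integrable c f \<longleftrightarrow>
      vline_integrable c (\<lambda>w. \<Sum>k<N. poly p (of_real (x k)) / D k / (w - of_real (x k)))"
    by (rule vline_integrable_cong) (rule eq)
  then show "vline_integrable c f"
    using vline_integral_partial_fractions(1)[OF c 0] by simp
  have "vline_integral c f =
      vline_integral c (\<lambda>w. \<Sum>k<N. poly p (of_real (x k)) / D k / (w - of_real (x k)))"
    by (rule vline_integral_cong) (rule eq)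
  then show "vline_integral c f = 2 * of_real pi * \<i> * (\<Sum>k | k < N \<and> c < x k. poly p (of_real (x k)) / D k)"
    using vline_integral_partial_fractions(2)[OF c 0] by simp
qed

lemma iter_vline_integral_cong:
  assumes "\<And>w. length w = length c \<Longrightarrow> (\<And>r. r < length c \<Longrightarrow> Re (w ! r) = c ! r) \<Longrightarrow> f w = g w"
  shows "iter_vline_integral c f = iter_vline_integral c g"
  using assms
proof (induction c arbitrary: f g)
  case (Cons c0 c)
  show ?case
    unfolding iter_vline_integral.simps
  proof (intro vline_integral_cong Cons.IH Cons.prems)
    fix w0 w r assume "Re w0 = c0" "length w = length c" "\<And>r. r < length c \<Longrightarrow> Re (w ! r) = c ! r"
      "r < length (c0 # c)"
    then show "Re ((w0 # w) ! r) = (c0 # c) ! r" by (cases r) auto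
  qed auto
qed auto

text \<open>Linearity alone separates the variables of a finite sum of products. The coefficients
  \<open>C\<close> are generalised in the induction because the factor in the first variable is a
  constant for the inner integrals.\<close>

lemma iter_vline_integral_sum_prod:
  assumes "finite P" "\<And>p r. p \<in> P \<Longrightarrow> r < length c \<Longrightarrow> vline_integrable (c ! r) (h p r)"
  shows "iter_vline_integral c (\<lambda>w. \<Sum>p\<in>P. C p * (\<Prod>r<length c. h p r (w ! r))) =
    (\<Sum>p\<in>P. C p * (\<Prod>r<length c. vline_integral (c ! r) (h p r)))"
  using assms(2)
proof (induction c arbitrary: h C)
  case (Cons c0 c)
  have "iter_vline_integral (c0 # c) (\<lambda>w. \<Sum>p\<in>P. C p * (\<Prod>r<length (c0 # c). h p r (w ! r))) =
      vline_integral c0 (\<lambda>w0. iter_vline_integral c (\<lambda>w. \<Sum>p\<in>P. (C p * h p 0 w0) *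
        (\<Prod>r<length c. h p (Suc r) (w ! r))))"
    by (simp add: prod.lessThan_Suc_shift mult.assoc del: prod.lessThan_Suc)
  also have "\<dots> = vline_integral c0 (\<lambda>w0. \<Sum>p\<in>P. (C p * h p 0 w0) *
        (\<Prod>r<length c. vline_integral (c ! r) (h p (Suc r))))"
    using Cons.prems[where r = "Suc _"] by (subst Cons.IH) auto
  also have "\<dots> = (\<Sum>p\<in>P. (\<Prod>r<length c. vline_integral (c ! r) (h p (Suc r))) * C p * vline_integral c0 (h p 0))"
  proof -
    define Q where "Q p = (\<Prod>r<length c. vline_integral (c ! r) (h p (Suc r)))" for p
    have "integrable lborel (\<lambda>t. h p 0 (of_real c0 - \<i> * of_real t) * (- \<i>))" if "p \<in> P" for p
      using Cons.prems[OF that, of 0] by (simp add: vline_integrable_def)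
    then have "(LBINT t. \<Sum>p\<in>P. Q p * C p * (h p 0 (of_real c0 - \<i> * of_real t) * (- \<i>))) =
        (\<Sum>p\<in>P. LBINT t. Q p * C p * (h p 0 (of_real c0 - \<i> * of_real t) * (- \<i>)))"
      by (intro Bochner_Integration.integral_sum integrable_mult_right)
    also have "\<dots> = (\<Sum>p\<in>P. Q p * C p * (LBINT t. h p 0 (of_real c0 - \<i> * of_real t) * (- \<i>)))"
      by (intro sum.cong refl integral_mult_right_zero)
    also have "(\<lambda>t. \<Sum>p\<in>P. Q p * C p * (h p 0 (of_real c0 - \<i> * of_real t) * (- \<i>))) =
        (\<lambda>t. (\<Sum>p\<in>P. C p * h p 0 (of_real c0 - \<i> * of_real t) * Q p) * (- \<i>))"
      unfolding sum_distrib_right by (intro ext sum.cong refl) simp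
    finally show ?thesis unfolding vline_integral_def Q_def .
  qed
  finally show ?case
    by (simp add: prod.lessThan_Suc_shift mult_ac del: prod.lessThan_Suc)
qed auto

section \<open>Explicit iterated primitives\<close>

lemma qpoch_Suc: "qpoch a q (Suc n) = qpoch a q n * (1 - a * q ^ n)"
  by (simp add: qpoch_def)

lemma qpoch_0 [simp]: "qpoch a q 0 = 1"
  by (simp add: qpoch_def)

lemma qpoch_Suc_shift: "qpoch a q (Suc n) = (1 - a) * qpoch (a * q) q n"
  unfolding qpoch_def by (subst prod.lessThan_Suc_shift) (simp add: mult_ac)

lemma of_real_qpoch:
  "of_real (qpoch a q n) = (qpoch (of_real a) (of_real q) n :: 'a :: {comm_ring_1, real_algebra_1})"
  by (simp add: qpoch_def)

text \<open>The \<open>k\<close>-th iterated \<open>q\<close>-primitives of \<open>\<delta>\<^sub>a\<close> and of \<open>1 / (x u; q)\<^bsub>M + 1\<^esub>\<close>.\<close>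

definition delta_primitive :: "real \<Rightarrow> real \<Rightarrow> nat \<Rightarrow> real \<Rightarrow> real" where
  "delta_primitive q a k x =
     (if k = 0 then (if x = a then 1 else 0)
      else if 0 < a \<and> a \<le> x \<or> a < 0 \<and> x \<le> a
      then a * (\<Prod>i<k - 1. x - a * q ^ Suc i) / qpoch q q (k - 1) else 0)"

definition kernel_primitive :: "complex \<Rightarrow> complex \<Rightarrow> nat \<Rightarrow> nat \<Rightarrow> complex \<Rightarrow> complex" where
  "kernel_primitive q u M k x =
     qpoch q q (M - k) / (qpoch q q M * u ^ k * qpoch (x * u) q (M + 1 - k))"

text \<open>The \<open>q\<close>-analogue of differentiating a power. Replacing \<open>x\<close> by
  \<open>x * q\<close> shifts every root by one index, so the two products share all factors but
  one.\<close>

lemma prod_q_difference: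
  fixes x a q :: "'a :: comm_ring_1"
  shows "(\<Prod>i<Suc n. x - a * q ^ Suc i) - (\<Prod>i<Suc n. x * q - a * q ^ Suc i) =
    x * (1 - q ^ Suc n) * (\<Prod>i<n. x - a * q ^ Suc i)"
proof -
  have "(\<Prod>i<Suc n. x * q - a * q ^ Suc i) = (\<Prod>i<Suc n. q * (x - a * q ^ i))"
    by (intro prod.cong) (auto simp: algebra_simps)
  also have "\<dots> = q ^ Suc n * (\<Prod>i<Suc n. x - a * q ^ i)"
    unfolding prod.distrib by (simp only: prod_constant card_lessThan)
  also have "(\<Prod>i<Suc n. x - a * q ^ i) = (x - a) * (\<Prod>i<n. x - a * q ^ Suc i)"
    by (subst prod.lessThan_Suc_shift) simp
  finally have "(\<Prod>i<Suc n. x * q - a * q ^ Suc i) = q ^ Suc n * ((x - a) * (\<Prod>i<n. x - a * q ^ Suc i))" .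
  then show ?thesis
    unfolding prod.lessThan_Suc by (simp add: algebra_simps)
qed

context q_lattice
begin

lemma qpoch_neq_0: "qpoch q q n \<noteq> 0"
  using qpoch_pos[of n] by simp

lemma locally_bdd_continuous:
  assumes "continuous_on UNIV \<phi>"
  shows "locally_bdd \<phi>"
  unfolding locally_bdd_def
proof
  fix R
  have "compact (\<phi> ` {-R..R})"
    by (intro compact_continuous_image continuous_on_subset[OF assms]) auto
  then have "bounded (\<phi> ` {-R..R})" by (rule compact_imp_bounded)
  then obtain B where "\<forall>z\<in>\<phi> ` {-R..R}. norm z \<le> B" by (auto simp only: bounded_iff)
  then show "\<exists>B. \<forall>y\<in>L. \<bar>y\<bar> \<le> R \<longrightarrow> norm (\<phi> y) \<le> B"
    by (intro exI[of _ B]) (auto simp: abs_le_iff)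
qed

lemma locally_bdd_le:
  assumes "locally_bdd \<psi>" "\<And>x. norm (\<phi> x) \<le> norm (\<psi> x)"
  shows "locally_bdd \<phi>"
  using assms unfolding locally_bdd_def by (meson order_trans)

lemma continuous_imp_tendsto_at_0:
  fixes \<Phi> :: "real \<Rightarrow> complex"
  assumes "continuous_on UNIV \<Phi>" shows "\<exists>l. (\<Phi> \<longlongrightarrow> l) (at 0)"
proof
  show "(\<Phi> \<longlongrightarrow> \<Phi> 0) (at 0)"
    using assms by (simp add: continuous_on_eq_continuous_at continuous_at)
qed

text \<open>These are the iterated primitives of the added column of ones, with
  \<open>(q; q)\<close> of index \<open>j\<close> in the role of a factorial.\<close>

lemma q_primitive_power:
  "q_primitive (\<lambda>x. of_real (x ^ j / qpoch q q j)) (\<lambda>x. of_real (x ^ Suc j / qpoch q q (Suc j)))"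
  unfolding q_primitive_def
proof (intro conjI ballI)
  show "locally_bdd (\<lambda>x. of_real (x ^ j / qpoch q q j))"
    by (intro locally_bdd_continuous continuous_intros) (simp add: qpoch_neq_0)
  show "\<exists>l. ((\<lambda>x. of_real (x ^ Suc j / qpoch q q (Suc j)) :: complex) \<longlongrightarrow> l) (at 0)"
    by (intro continuous_imp_tendsto_at_0 continuous_intros) (simp add: qpoch_neq_0)
  fix x
  have *: "1 - q * q ^ j \<noteq> 0" using qpoch_neq_0[of "Suc j"] by (simp add: qpoch_Suc)
  have "x ^ Suc j - (x * q) ^ Suc j = x * x ^ j * (1 - q * q ^ j)"
    by (simp add: power_mult_distrib algebra_simps)
  then have "x ^ Suc j / qpoch q q (Suc j) - (x * q) ^ Suc j / qpoch q q (Suc j) = x * (x ^ j / qpoch q q j)"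
    using * by (simp only: qpoch_Suc diff_divide_distrib[symmetric]) simp
  then show "of_real (x ^ Suc j / qpoch q q (Suc j)) - of_real ((x * q) ^ Suc j / qpoch q q (Suc j)) =
      of_real x * (of_real (x ^ j / qpoch q q j) :: complex)"
    by (metis of_real_diff of_real_mult)
qed

text \<open>Between \<open>x * q\<close> and \<open>x\<close> there is no further lattice point, so
  a single step along the ray passes the threshold \<open>a\<close> only if it starts at
  \<open>a\<close>.\<close>

lemma lattice_gap:
  assumes "a \<in> L" "x \<in> L" and "0 < a \<and> a \<le> x \<and> x * q < a \<or> a < 0 \<and> x \<le> a \<and> a < x * q"
  shows "x = a"
proof -
  have "a \<in> range (\<lambda>k::nat. x * q ^ k)"
    unfolding lattice_ray[OF assms(2)] using assms by auto
  then obtain k where k: "a = x * q ^ k" by auto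
  show ?thesis
  proof (cases k)
    case (Suc n)
    have "q ^ n \<le> 1" "0 \<le> q ^ n" using q_pos q_less_1 by (auto simp: power_le_one)
    then have "\<bar>x * q * q ^ n\<bar> \<le> \<bar>x * q\<bar>"
      by (simp add: abs_mult mult_left_le)
    moreover have "a = x * q * q ^ n" using k Suc by simp
    ultimately have "\<bar>a\<bar> \<le> \<bar>x * q\<bar>" by simp
    moreover have "x > 0 \<Longrightarrow> x * q > 0" "x < 0 \<Longrightarrow> x * q < 0"
      using q_pos by (auto simp: mult_neg_pos)
    ultimately show ?thesis using assms(3) by linarith
  qed (use k in simp)
qed

text \<open>The support condition \<open>?S\<close> can change between \<open>x\<close> and
  \<open>x * q\<close> only at \<open>x = a\<close>. For \<open>k = 0\<close> this jump is the delta
  itself; for larger \<open>k\<close> the polynomial has the root \<open>a * q\<close>, so cutting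
  it off there changes no value and \<open>prod_q_difference\<close> applies.\<close>

lemma delta_primitive_difference:
  assumes a: "a \<in> L" and x: "x \<in> L"
  shows "delta_primitive q a (Suc k) x - delta_primitive q a (Suc k) (x * q) = x * delta_primitive q a k x"
proof -
  let ?S = "\<lambda>x. 0 < a \<and> a \<le> x \<or> a < 0 \<and> x \<le> a"
  have S: "?S x" if "?S (x * q)"
  proof -
    have "\<bar>x * q\<bar> \<le> \<bar>x\<bar>" using q_pos q_less_1 by (auto simp: abs_mult mult_left_le)
    moreover have "x * q > 0 \<longleftrightarrow> x > 0" "x * q < 0 \<longleftrightarrow> x < 0"
      using q_pos by (auto simp: zero_less_mult_iff mult_less_0_iff)
    ultimately show ?thesis using that by linarith
  qed
  have gap: "x = a" if "?S x" "\<not> ?S (x * q)"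
    using lattice_gap[OF a x] that by auto
  have a_in: "?S a" "a \<noteq> 0" using lattice_neq_0[OF a] by auto
  show ?thesis
  proof (cases k)
    case 0
    have "\<not> ?S (a * q)"
      using q_pos q_less_1 lattice_neq_0[OF a] by auto
    then show ?thesis
      using 0 S gap a_in by (auto simp: delta_primitive_def)
  next
    case (Suc n)
    have D: "delta_primitive q a (Suc (Suc n)) y =
        (if ?S y then a * (\<Prod>i<Suc n. y - a * q ^ Suc i) / qpoch q q (Suc n) else 0)" for y
      by (simp add: delta_primitive_def)
    have E: "delta_primitive q a (Suc n) y =
        (if ?S y then a * (\<Prod>i<n. y - a * q ^ Suc i) / qpoch q q n else 0)" for y
      by (simp add: delta_primitive_def)
    show ?thesis
    proof (cases "?S x")
      case True
      have "1 - q ^ Suc n \<noteq> 0" using qpoch_neq_0[of "Suc n"] by (simp add: qpoch_Suc)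
      have "(\<Prod>i<Suc n. a * q - a * q ^ Suc i) = 0"
        by (subst prod.lessThan_Suc_shift) simp
      then have "delta_primitive q a (Suc (Suc n)) (x * q) =
          a * (\<Prod>i<Suc n. x * q - a * q ^ Suc i) / qpoch q q (Suc n)"
        using gap[OF True] unfolding D by (cases "?S (x * q)") auto
      then have "delta_primitive q a (Suc (Suc n)) x - delta_primitive q a (Suc (Suc n)) (x * q) =
          a * ((\<Prod>i<Suc n. x - a * q ^ Suc i) - (\<Prod>i<Suc n. x * q - a * q ^ Suc i)) / qpoch q q (Suc n)"
        using True unfolding D by (simp only: if_True right_diff_distrib diff_divide_distrib)
      also have "\<dots> = x * delta_primitive q a (Suc n) x"
        unfolding prod_q_difference E
        using True \<open>1 - q ^ Suc n \<noteq> 0\<close> qpoch_neq_0[of n] by (simp add: qpoch_Suc)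
      finally show ?thesis using Suc by simp
    next
      case False
      then have "\<not> ?S (x * q)" using S by blast
      with False show ?thesis unfolding Suc D E by (simp only: if_False)
    qed
  qed
qed

text \<open>The support lies on the far side of \<open>a\<close> from 0, so the primitive vanishes
  near 0 and has the limit 0 from both sides. Local bounds come from the polynomial without the
  cut-off.\<close>

lemma q_primitive_delta:
  assumes a: "a \<in> L"
  shows "q_primitive (\<lambda>x. of_real (delta_primitive q a k x)) (\<lambda>x. of_real (delta_primitive q a (Suc k) x))"
  unfolding q_primitive_def
proof (intro conjI ballI)
  have "continuous_on UNIV (\<lambda>x. of_real (if k = 0 then 1 else a * (\<Prod>i<k - 1. x - a * q ^ Suc i) / qpoch q q (k - 1)) :: complex)"
    by (cases "k = 0") (auto intro!: continuous_intros simp: qpoch_neq_0)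
  then show "locally_bdd (\<lambda>x. of_real (delta_primitive q a k x))"
    by (rule locally_bdd_le[OF locally_bdd_continuous]) (auto simp: delta_primitive_def)
  have "\<forall>\<^sub>F x in at 0. delta_primitive q a (Suc k) x = 0"
    unfolding eventually_at using lattice_neq_0[OF a]
    by (intro exI[of _ "\<bar>a\<bar>"]) (auto simp: delta_primitive_def)
  then have "((\<lambda>x. of_real (delta_primitive q a (Suc k) x) :: complex) \<longlongrightarrow> 0) (at 0)"
    by (intro tendsto_eventually) (auto elim: eventually_mono)
  then show "\<exists>l. ((\<lambda>x. of_real (delta_primitive q a (Suc k) x) :: complex) \<longlongrightarrow> l) (at 0)" by (rule exI)
  show "of_real (delta_primitive q a (Suc k) x) - of_real (delta_primitive q a (Suc k) (x * q)) =
      of_real x * (of_real (delta_primitive q a k x) :: complex)" if "x \<in> L" for x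
    using delta_primitive_difference[OF a that, of k] by (metis of_real_diff of_real_mult)
qed

lemma qpoch_nonreal_neq_0:
  fixes u :: complex
  assumes "u \<notin> \<real>"
  shows "qpoch (of_real x * u) (of_real q) n \<noteq> 0"
proof -
  have "1 - of_real x * u * of_real q ^ i \<noteq> 0" for i
  proof
    assume *: "1 - of_real x * u * of_real q ^ i = 0"
    then have "of_real (x * q ^ i) * u = 1" by (simp add: mult_ac)
    then have "u = of_real (inverse (x * q ^ i))"
      by (metis inverse_unique of_real_inverse)
    then show False using assms by simp
  qed
  then show ?thesis by (simp add: qpoch_def)
qed

text \<open>With \<open>y = x * u\<close>, the denominators at \<open>y\<close> and
  \<open>y * q\<close> share the factor \<open>p\<close>, and the difference of reciprocals has
  numerator \<open>y * (1 - q ^ (M - k))\<close>. The power of \<open>q\<close> is absorbed by the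
  quotient of consecutive \<open>(q; q)\<close>, the factor \<open>u\<close> by the extra power of
  \<open>u\<close> in the denominator.\<close>

lemma q_primitive_kernel:
  assumes u: "u \<notin> \<real>" and k: "k < M"
  shows "q_primitive (\<lambda>x. kernel_primitive (of_real q) u M k (of_real x))
                     (\<lambda>x. kernel_primitive (of_real q) u M (Suc k) (of_real x))"
proof -
  have u0: "u \<noteq> 0" using u by auto
  have q0: "qpoch (of_real q) (of_real q) n \<noteq> (0 :: complex)" for n
    using qpoch_neq_0[of n] by (simp flip: of_real_qpoch)
  have cont: "continuous_on UNIV (\<lambda>x. kernel_primitive (of_real q) u M k (of_real x))" for k
  proof -
    have "continuous_on UNIV (\<lambda>x. qpoch (of_real x * u) (of_real q) n)" for n
      unfolding qpoch_def by (intro continuous_intros)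
    then show ?thesis
      unfolding kernel_primitive_def
      by (intro continuous_on_divide continuous_on_mult continuous_on_const)
        (use u0 q0 qpoch_nonreal_neq_0[OF u] in auto)
  qed
  have "kernel_primitive (of_real q) u M (Suc k) (of_real x) - kernel_primitive (of_real q) u M (Suc k) (of_real (x * q)) =
      of_real x * kernel_primitive (of_real q) u M k (of_real x)" for x
  proof -
    obtain n where n: "M - k = Suc n" using k by (metis Suc_diff_Suc)
    then have n': "M - Suc k = n" "M + 1 - k = Suc (Suc n)" "M + 1 - Suc k = Suc n" using k by auto
    define y Q where "y = of_real x * u" and "Q = complex_of_real q"
    define p where "p = qpoch (y * Q) Q n"
    have nz: "qpoch y Q n \<noteq> 0" for n
      unfolding y_def Q_def by (rule qpoch_nonreal_neq_0[OF u])
    have p0: "p \<noteq> 0" "1 - y \<noteq> 0"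
      using nz[of "Suc n"] unfolding qpoch_Suc_shift p_def by auto
    have p1: "1 - y * Q * Q ^ n \<noteq> 0"
      using nz[of "Suc (Suc n)"] unfolding qpoch_Suc[of _ _ "Suc n"] by (auto simp: mult_ac)
    have A: "qpoch y Q (Suc n) = (1 - y) * p" by (simp add: qpoch_Suc_shift p_def)
    have B: "qpoch (y * Q) Q (Suc n) = p * (1 - y * Q * Q ^ n)" by (simp add: qpoch_Suc p_def)
    have C: "qpoch y Q (Suc (Suc n)) = (1 - y) * (p * (1 - y * Q * Q ^ n))"
      by (simp add: qpoch_Suc_shift[of _ _ "Suc n"] B)
    have E: "qpoch Q Q (Suc n) = qpoch Q Q n * (1 - Q * Q ^ n)" by (simp add: qpoch_Suc)
    have "1 / ((1 - y) * p) - 1 / (p * (1 - y * Q * Q ^ n)) =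
        y * (1 - Q * Q ^ n) / ((1 - y) * (p * (1 - y * Q * Q ^ n)))"
      using p0 p1 by (simp add: divide_simps) (simp add: algebra_simps)
    then have "qpoch Q Q n / (qpoch Q Q M * u ^ Suc k) * (1 / ((1 - y) * p) - 1 / (p * (1 - y * Q * Q ^ n))) =
        qpoch Q Q n / (qpoch Q Q M * u ^ Suc k) * (y * (1 - Q * Q ^ n) / ((1 - y) * (p * (1 - y * Q * Q ^ n))))"
      by simp
    also have "\<dots> = of_real x * (qpoch Q Q (Suc n) / (qpoch Q Q M * u ^ k * ((1 - y) * (p * (1 - y * Q * Q ^ n)))))"
      unfolding E using u0 by (simp add: y_def)
    also have "\<dots> = kernel_primitive Q u M k (of_real x) * of_real x"
      unfolding kernel_primitive_def n n' y_def[symmetric] C by simp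
    finally have eq: "qpoch Q Q n / (qpoch Q Q M * u ^ Suc k) * (1 / ((1 - y) * p)) -
        qpoch Q Q n / (qpoch Q Q M * u ^ Suc k) * (1 / (p * (1 - y * Q * Q ^ n))) =
        kernel_primitive Q u M k (of_real x) * of_real x"
      by (simp only: right_diff_distrib)
    have "of_real (x * q) * u = y * Q" by (simp add: y_def Q_def)
    then have "kernel_primitive Q u M (Suc k) (of_real (x * q)) =
        qpoch Q Q n / (qpoch Q Q M * u ^ Suc k) * (1 / (p * (1 - y * Q * Q ^ n)))"
      unfolding kernel_primitive_def n' by (simp add: B)
    moreover have "kernel_primitive Q u M (Suc k) (of_real x) =
        qpoch Q Q n / (qpoch Q Q M * u ^ Suc k) * (1 / ((1 - y) * p))"
      unfolding kernel_primitive_def n' y_def[symmetric] A by simp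
    ultimately show ?thesis
      using eq unfolding Q_def by (simp only: mult.commute)
  qed
  then show ?thesis
    unfolding q_primitive_def
    using locally_bdd_continuous[OF cont] continuous_imp_tendsto_at_0[OF cont] by blast
qed

end

section \<open>The function as a ratio of determinants\<close>

lemma det_scale_columns:
  "Determinant.det (mat n n (\<lambda>(i, j). d j * g i j)) = (\<Prod>j<n. d j) * Determinant.det (mat n n (\<lambda>(i, j). g i j))"
proof -
  have "(\<Prod>i<n. d (p i)) = (\<Prod>j<n. d j)" if "p permutes {0..<n}" for p
    using prod.permute[OF that, of d] by (simp add: o_def atLeast0LessThan)
  then show ?thesis
    by (simp add: det_mat_eq prod.distrib sum_distrib_left mult_ac)
qed

lemma det_zero_column:
  assumes "r < n" "\<And>i. i < n \<Longrightarrow> f (i, r) = 0"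
  shows "Determinant.det (mat n n f) = 0"
proof -
  have "(\<Prod>i<n. f (i, p i)) = 0" if p: "p permutes {0..<n}" for p
  proof (rule prod_zero)
    show "\<exists>i\<in>{..<n}. f (i, p i) = 0"
      using permutes_surj[OF p] permutes_in_image[OF p] assms
      by (metis atLeast0LessThan lessThan_iff surjD)
  qed auto
  then show ?thesis by (simp add: det_mat_eq)
qed

text \<open>Up to a fixed sign \<open>V\<close> is a determinant of the same shape, so reordering
  the points multiplies numerator and denominator by the same sign. This allows \<open>A\<close> to
  be listed before the rest of \<open>Y\<close>.\<close>

lemma det_over_vandermonde_perm:
  fixes xs ys :: "real list" and \<phi> :: "nat \<Rightarrow> real \<Rightarrow> complex"
  assumes "mset ys = mset xs" "length xs = n"
  shows "Determinant.det (mat n n (\<lambda>(i, j). \<phi> j (ys ! i))) / of_real (vandermonde ys) =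
         Determinant.det (mat n n (\<lambda>(i, j). \<phi> j (xs ! i))) / of_real (vandermonde xs)"
proof -
  obtain p where p: "p permutes {..<n}" "permute_list p xs = ys"
    using mset_eq_permutation[OF assms(1)] assms(2) by blast
  have len: "length ys = n" using assms by (metis mset_eq_length)
  have perm: "Determinant.det (mat n n (\<lambda>(i, j). \<psi> j (ys ! i))) =
      signof p * Determinant.det (mat n n (\<lambda>(i, j). \<psi> j (xs ! i)))" for \<psi> :: "nat \<Rightarrow> real \<Rightarrow> complex"
  proof -
    have p': "p permutes {0..<n}" using p by (simp add: atLeast0LessThan)
    have "p i < n" "ys ! i = xs ! p i" if "i < n" for i
      using that p assms(2) permutes_in_image[OF p(1), of i] permute_list_nth[of p xs i] by auto
    then have "mat n n (\<lambda>(i, j). \<psi> j (ys ! i)) =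
        mat n n (\<lambda>(i, j). mat n n (\<lambda>(i, j). \<psi> j (xs ! i)) $$ (p i, j))"
      by (intro eq_matI) simp_all
    then show ?thesis by (simp add: det_permute_rows[OF _ p'])
  qed
  have "of_real (vandermonde zs) = (rev_sign n * Determinant.det (mat n n (\<lambda>(i, j). of_real (zs ! i) ^ j)) :: complex)"
    if "length zs = n" for zs :: "real list"
  proof -
    have "mat n n (\<lambda>(i, j). map complex_of_real zs ! i ^ j) = mat n n (\<lambda>(i, j). of_real (zs ! i) ^ j)"
      using that by (intro eq_matI) simp_all
    then show ?thesis
      using vandermonde_eq_det[of "map complex_of_real zs"] that
      by (simp add: vandermonde_map_of_real)
  qed
  then show ?thesis
    using perm[of \<phi>] perm[of "\<lambda>j x. of_real x ^ j"] len assms(2)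
    by (simp add: sign_def)
qed

context q_lattice
begin

text \<open>The \<open>j\<close>-th column after \<open>k\<close> steps: the first \<open>k\<close> columns come from the added columns of ones.\<close>

definition lift_fun :: "real list \<Rightarrow> complex list \<Rightarrow> nat \<Rightarrow> nat \<Rightarrow> nat \<Rightarrow> real \<Rightarrow> complex" where
  "lift_fun a z M k j =
     (if j < k then (\<lambda>x. of_real (x ^ j / qpoch q q j))
      else if j - k < length a then (\<lambda>x. of_real (delta_primitive q (a ! (j - k)) k x))
      else (\<lambda>x. kernel_primitive (of_real q) (inverse (z ! (j - k - length a))) M k (of_real x)))"

lemma q_primitive_lift_fun:
  assumes "set a \<subseteq> L" "set z \<inter> \<real> = {}" "j < length a + length z + k" "k < M"
  shows "q_primitive (lift_fun a z M k j) (lift_fun a z M (Suc k) (Suc j))"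
proof -
  consider "j < k" | "k \<le> j" "j - k < length a" | "k \<le> j" "\<not> j - k < length a" by linarith
  then show ?thesis
  proof cases
    case 1
    then show ?thesis using q_primitive_power[of j] by (simp add: lift_fun_def)
  next
    case 2
    then have "a ! (j - k) \<in> L" using assms(1) by auto
    then show ?thesis using 2 q_primitive_delta[of "a ! (j - k)" k] by (simp add: lift_fun_def)
  next
    case 3
    then have "z ! (j - k - length a) \<in> set z" using assms(3) by (intro nth_mem) linarith
    then have "z ! (j - k - length a) \<notin> \<real>" using assms(2) by blast
    then have "inverse (z ! (j - k - length a)) \<notin> \<real>" by (metis Reals_inverse inverse_inverse_eq)
    then show ?thesis
      using 3 q_primitive_kernel[OF _ assms(4)] by (simp add: lift_fun_def)
  qed
qed

text \<open>With \<open>Y\<close> listed as \<open>a\<close> followed by the remaining points, the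
  delta columns are an identity block above zeros, which leaves the kernel determinant on
  \<open>Y - A\<close>; if a point of \<open>A\<close> is missing from \<open>Y\<close>, its column
  is zero. The power of -1 comes from the cross differences, \<open>rev_sign K\<close> from
  replacing \<open>V(Y)\<close> by its absolute value.\<close>

lemma f_AZ_eq_det_ratio:
  assumes a: "distinct a" and K: "K = length a + length z" and "K < N" and Y: "Y \<in> cf K"
  shows "f_AZ q (set a) z N K Y =
    of_real (vandermonde a) * (-1) ^ (length a * length z) * rev_sign K / vandermonde (map inverse z) *
    det_ratio K (lift_fun a z (N - K) 0) Y"
proof -
  define \<phi> where "\<phi> = lift_fun a z (N - K) 0"
  let ?m = "length a" and ?n = "length z"
  let ?D = "\<lambda>xs. Determinant.det (mat K K (\<lambda>(i, j). \<phi> j (xs ! i)))"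
  have delta: "\<phi> j x = (if x = a ! j then 1 else 0)" if "j < ?m" for j x
    using that by (simp add: \<phi>_def lift_fun_def delta_primitive_def)
  have q0: "qpoch (of_real q) (of_real q) k \<noteq> (0 :: complex)" for k
    using qpoch_neq_0[of k] by (simp flip: of_real_qpoch)
  have kernel: "\<phi> (?m + s) x = 1 / qpoch (of_real x * inverse (z ! s)) (of_real q) (N - K + 1)" for s x
    using q0 by (simp add: \<phi>_def lift_fun_def kernel_primitive_def)
  show ?thesis
  proof (cases "set a \<subseteq> Y")
    case False
    then obtain r where r: "r < ?m" "a ! r \<notin> Y" by (metis in_set_conv_nth subsetI)
    then have "sl Y ! i \<noteq> a ! r" if "i < K" for i
      using config_nth(1)[OF Y that] by metis
    then have "?D (sl Y) = 0"
      using r K by (intro det_zero_column[of r]) (auto simp: delta)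
    then show ?thesis using False by (simp add: f_AZ_def det_ratio_def \<phi>_def)
  next
    case True
    define ys where "ys = sl (Y - set a)"
    have fin: "finite Y" "card Y = K" using Y by (auto simp: configs_def)
    have set_ys: "set ys = Y - set a" and dist_ys: "distinct ys"
      using fin by (auto simp: ys_def)
    have "card (Y - set a) = ?n"
      using True fin K a by (simp add: card_Diff_subset distinct_card)
    then have len: "length ys = ?n" by (simp add: ys_def)
    have "mset (a @ ys) = mset (sl Y)"
      using a dist_ys set_ys True fin
      by (intro set_eq_iff_mset_eq_distinct[THEN iffD1]) auto
    then have perm: "?D (a @ ys) / of_real (vandermonde (a @ ys)) = ?D (sl Y) / of_real (vandermonde (sl Y))"
      using fin by (intro det_over_vandermonde_perm) auto
    define G where "G = mat ?n ?n (\<lambda>(i, j). 1 / qpoch (map of_real ys ! i * inverse (z ! j)) (complex_of_real q) (N - K + 1))"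
    define B where "B = mat ?m ?n (\<lambda>(i, j). \<phi> (?m + j) (a ! i))"
    have "mat K K (\<lambda>(i, j). \<phi> j ((a @ ys) ! i)) = four_block_mat (1\<^sub>m ?m) B (0\<^sub>m ?n ?m) G"
    proof (rule eq_matI)
      fix i j
      assume "i < dim_row (four_block_mat (1\<^sub>m ?m) B (0\<^sub>m ?n ?m) G)" "j < dim_col (four_block_mat (1\<^sub>m ?m) B (0\<^sub>m ?n ?m) G)"
      then have ij: "i < ?m + ?n" "j < ?m + ?n" by (auto simp: G_def)
      have "ys ! (i - ?m) \<in> set ys" if "\<not> i < ?m"
        using that ij len by (intro nth_mem) linarith
      then have ne: "ys ! (i - ?m) \<noteq> a ! j" if "\<not> i < ?m" "j < ?m"
        using that set_ys by (metis DiffE nth_mem)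
      have "\<phi> j x = \<phi> (?m + (j - ?m)) x" if "\<not> j < ?m" for x using that by simp
      then show "mat K K (\<lambda>(i, j). \<phi> j ((a @ ys) ! i)) $$ (i, j) = four_block_mat (1\<^sub>m ?m) B (0\<^sub>m ?n ?m) G $$ (i, j)"
        using ij ne len a kernel[of "j - ?m"]
        by (auto simp: K nth_append delta G_def B_def nth_eq_iff_index_eq)
    qed (auto simp: K G_def)
    moreover have "Determinant.det (four_block_mat (1\<^sub>m ?m) B (0\<^sub>m ?n ?m) G) = Determinant.det (1\<^sub>m ?m) * Determinant.det G"
      by (rule det_four_block_mat_lower_left_zero) (auto simp: B_def G_def)
    ultimately have D: "?D (a @ ys) = Determinant.det G" by simp
    let ?P = "\<Prod>s<?n. \<Prod>b\<in>set a. complex_of_real (ys ! s) - of_real b"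
    have "(\<Prod>s<?n. \<Prod>r<?m. a ! r - ys ! s) = (-1) ^ (?m * ?n) * (\<Prod>s<?n. \<Prod>b\<in>set a. ys ! s - b)"
    proof -
      have "(\<Prod>r<?m. a ! r - ys ! s) = (-1) ^ ?m * (\<Prod>b\<in>set a. ys ! s - b)" for s
      proof -
        have "(\<Prod>b\<in>set a. ys ! s - b) = (\<Prod>r<?m. ys ! s - a ! r)"
          using a by (intro prod.reindex_bij_betw[symmetric] bij_betw_nth) auto
        moreover have "(\<Prod>r<?m. a ! r - ys ! s) = (\<Prod>r<?m. (-1) * (ys ! s - a ! r))" by simp
        ultimately show ?thesis unfolding prod.distrib by (simp only: prod_constant card_lessThan)
      qed
      then show ?thesis by (simp add: prod.distrib power_mult)
    qed
    then have "vandermonde (a @ ys) = vandermonde a * vandermonde ys * ((-1) ^ (?m * ?n) * (\<Prod>s<?n. \<Prod>b\<in>set a. ys ! s - b))"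
      using len by (simp add: vandermonde_append)
    then have V: "complex_of_real (vandermonde (a @ ys)) =
        of_real (vandermonde a) * vandermonde (map of_real ys) * (-1) ^ (?m * ?n) * ?P"
      by (simp add: vandermonde_map_of_real)
    have "f_AZ q (set a) z N K Y = Determinant.det G / (vandermonde (map of_real ys) * vandermonde (map inverse z) * ?P)"
      using True len unfolding f_AZ_def Let_def ys_def[symmetric] G_def by simp
    also have "\<dots> = of_real (vandermonde a) * (-1) ^ (?m * ?n) / vandermonde (map inverse z) *
        (?D (a @ ys) / of_real (vandermonde (a @ ys)))"
      using vandermonde_neq_0[OF a] unfolding D V by (simp add: divide_simps flip: power_add)
    also have "\<dots> = of_real (vandermonde a) * (-1) ^ (?m * ?n) / vandermonde (map inverse z) *
        (?D (sl Y) / of_real (vandermonde (sl Y)))"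
      unfolding perm ..
    also have "of_real (vandermonde (sl Y)) = rev_sign K * (of_real \<bar>vandermonde (sl Y)\<bar> :: complex)"
      using vandermonde_sorted[OF config_list(3)[OF Y]] config_list(1)[OF Y]
      by (metis of_real_mult of_real_rev_sign)
    also have "?D (sl Y) / (rev_sign K * of_real \<bar>vandermonde (sl Y)\<bar>) = rev_sign K * det_ratio K \<phi> Y"
      unfolding det_ratio_def by (simp add: divide_simps)
    finally show ?thesis by (simp add: \<phi>_def)
  qed
qed

end

section \<open>Evaluation of the determinant\<close>

text \<open>The left side is the joint Vandermonde of \<open>w\<close> and \<open>u\<close> divided
  by that of \<open>u\<close>, up to sign. Expanding it over permutations separates the variables
  \<open>w ! r\<close>, and the prefactor is the one occurring in
  \<open>f_AZ_eq_det_ratio\<close>.\<close>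

lemma vandermonde_mult_cross_expansion:
  fixes w u :: "complex list"
  assumes "distinct u" "length w = m" "length u = n" "K = m + n"
  shows "vandermonde w * (\<Prod>s<n. \<Prod>r<m. u ! s - w ! r) =
    (-1) ^ (m * n) / vandermonde u * rev_sign K *
    (\<Sum>p | p permutes {0..<K}. signof p * (\<Prod>r<m. (w ! r) ^ p r) * (\<Prod>s<n. (u ! s) ^ p (m + s)))"
proof -
  have "(\<Prod>s<n. \<Prod>r<m. w ! r - u ! s) = (-1) ^ (m * n) * (\<Prod>s<n. \<Prod>r<m. u ! s - w ! r)"
  proof -
    have "(\<Prod>r<m. w ! r - u ! s) = (-1) ^ m * (\<Prod>r<m. u ! s - w ! r)" for s
    proof -
      have "(\<Prod>r<m. w ! r - u ! s) = (\<Prod>r<m. (-1) * (u ! s - w ! r))" by simp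
      then show ?thesis unfolding prod.distrib by (simp only: prod_constant card_lessThan)
    qed
    then show ?thesis by (simp add: prod.distrib power_mult)
  qed
  then have "vandermonde (w @ u) = vandermonde w * vandermonde u * ((-1) ^ (m * n) * (\<Prod>s<n. \<Prod>r<m. u ! s - w ! r))"
    using assms by (simp add: vandermonde_append)
  then have "(-1) ^ (m * n) / vandermonde u * vandermonde (w @ u) =
      ((-1) ^ (m * n) * (-1) ^ (m * n)) * (vandermonde w * (\<Prod>s<n. \<Prod>r<m. u ! s - w ! r))"
    using vandermonde_neq_0[OF assms(1)] by simp
  also have "\<dots> = vandermonde w * (\<Prod>s<n. \<Prod>r<m. u ! s - w ! r)"
    by (simp flip: power_mult_distrib)
  finally have "vandermonde w * (\<Prod>s<n. \<Prod>r<m. u ! s - w ! r) =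
      (-1) ^ (m * n) / vandermonde u * vandermonde (w @ u)" ..
  also have "vandermonde (w @ u) = rev_sign K *
      (\<Sum>p | p permutes {0..<K}. signof p * (\<Prod>i<m + n. ((w @ u) ! i) ^ p i))"
    using assms by (simp add: vandermonde_eq_det det_mat_eq)
  also have "(\<lambda>p. \<Prod>i<m + n. ((w @ u) ! i) ^ p i) = (\<lambda>p. (\<Prod>r<m. (w ! r) ^ p r) * (\<Prod>s<n. (u ! s) ^ p (m + s)))"
    using assms by (simp add: prod_lessThan_add nth_append)
  finally show ?thesis by (simp add: mult_ac)
qed

context q_lattice
begin

text \<open>The contour for \<open>a\<close> avoids the lattice and separates it exactly where
  \<open>delta_primitive\<close> switches on, so the support condition selects the poles on one side
  of the line.\<close>

lemma lattice_between:
  assumes "a \<in> L" "c \<in> open_segment a (a * q)" "x \<in> L"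
  shows "x \<noteq> c" and "0 < a \<Longrightarrow> a \<le> x \<longleftrightarrow> c < x" and "a < 0 \<Longrightarrow> x \<le> a \<longleftrightarrow> x < c" and "c \<noteq> 0"
proof -
  have a0: "a \<noteq> 0" using lattice_neq_0 assms(1) by blast
  have pos: "0 < a * q \<and> a * q < c \<and> c < a" if "0 < a"
    using that assms(2) q_pos q_less_1 by (auto simp: open_segment_eq_real_ivl split: if_splits)
  have neg: "a < c \<and> c < a * q \<and> a * q < 0" if "a < 0"
    using that assms(2) q_pos q_less_1 by (auto simp: open_segment_eq_real_ivl mult_neg_pos split: if_splits)
  have gap_pos: "a \<le> x" if "0 < a" "a * q < x"
    using lattice_gap[OF assms(3,1)] that pos[OF that(1)] by force
  have gap_neg: "x \<le> a" if "a < 0" "x < a * q"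
    using lattice_gap[OF assms(3,1)] that neg[OF that(1)] by force
  show "x \<noteq> c" "c \<noteq> 0"
    using a0 pos neg gap_pos gap_neg by fastforce+
  show "a \<le> x \<longleftrightarrow> c < x" if "0 < a" using that pos gap_pos by force
  show "x \<le> a \<longleftrightarrow> x < c" if "a < 0" using that neg gap_neg by force
qed

lemma prod_config:
  assumes "X \<in> cf N" shows "(\<Prod>x\<in>X. f x) = (\<Prod>k<N. f (sl X ! k))"
  using config_list[OF assms]
  by (intro prod.reindex_bij_betw[symmetric] bij_betw_nth) auto

lemma inj_on_config: "X \<in> cf N \<Longrightarrow> inj_on (\<lambda>k. sl X ! k) {..<N}"
  using config_list[of X N] by (auto intro: inj_on_nth)

abbreviation sl_deriv :: "nat \<Rightarrow> real set \<Rightarrow> nat \<Rightarrow> complex" where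
  "sl_deriv N X k \<equiv> \<Prod>l\<in>{..<N} - {k}. of_real (sl X ! k) - of_real (sl X ! l)"

text \<open>For \<open>a < 0\<close> the primitive of \<open>\<delta>\<^sub>a\<close> lives to the left of the line; as all residues sum to zero, this
  only changes the sign, which turns the factor \<open>a\<close> into \<open>\<bar>a\<bar>\<close>.\<close>

lemma vline_integral_delta_column:
  assumes X: "X \<in> cf N" and N: "N = M + K" and M: "0 < M" and i: "i < K"
    and a: "a \<in> L" and c: "c \<in> open_segment a (a * q)"
  defines "h \<equiv> \<lambda>w. inverse w ^ i * (qpoch (of_real a * inverse w * of_real q) (of_real q) (M - 1) /
      (\<Prod>x\<in>X. 1 - of_real x * inverse w)) * (1 / w\<^sup>2)"
  shows "vline_integrable c h"
    and "(\<Sum>k<N. of_real (sl X ! k) ^ (K - 1 - i) * of_real (delta_primitive q a M (sl X ! k)) / sl_deriv N X k) =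
      of_real (\<bar>a\<bar> / qpoch q q (M - 1)) / (2 * of_real pi * \<i>) * vline_integral c h"
proof -
  \<comment> \<open>The numerator of \<open>h\<close> after clearing inverse powers of
    \<open>w\<close>: \<open>i\<close>, \<open>M - 1\<close> and 2 of them against
    \<open>N = M + K\<close> in the denominator leave \<open>w ^ (K - 1 - i)\<close>. This is the
    weight in the Lagrange sum, and the degree is at most \<open>N - 2\<close>.\<close>
  define p :: "complex poly" where
    "p = monom 1 (K - 1 - i) * (\<Prod>l<M - 1. [:- of_real (a * q ^ Suc l), 1:])"
  have "degree p \<le> (K - 1 - i) + (M - 1)"
    unfolding p_def
    by (rule order.trans[OF degree_mult_le]) (simp add: degree_monom_eq degree_prod_eq_sum_degree)
  then have deg: "degree p + 1 < N" using N M i by simp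
  have poly_p: "poly p w = w ^ (K - 1 - i) * (\<Prod>l<M - 1. w - of_real (a * q ^ Suc l))" for w
    by (simp add: p_def poly_monom poly_prod)
  have xL: "sl X ! k \<in> L" if "k < N" for k using config_nth(2)[OF X that] .
  note between = lattice_between[OF a c xL]
  have h: "h w = poly p w / (\<Prod>k<N. w - of_real (sl X ! k))" if "Re w = c" for w
  proof -
    have w: "w \<noteq> 0" using that lattice_between(4)[OF a c a] by auto
    have "qpoch (of_real a * inverse w * of_real q) (of_real q) (M - 1) =
        (\<Prod>l<M - 1. inverse w * (w - of_real (a * q ^ Suc l)))"
      unfolding qpoch_def using w by (intro prod.cong) (auto simp: field_simps)
    also have "\<dots> = inverse w ^ (M - 1) * (\<Prod>l<M - 1. w - of_real (a * q ^ Suc l))"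
      unfolding prod.distrib by (simp only: prod_constant card_lessThan)
    finally have 1: "qpoch (of_real a * inverse w * of_real q) (of_real q) (M - 1) =
        inverse w ^ (M - 1) * (\<Prod>l<M - 1. w - of_real (a * q ^ Suc l))" .
    have "(\<Prod>x\<in>X. 1 - of_real x * inverse w) = (\<Prod>k<N. inverse w * (w - of_real (sl X ! k)))"
      unfolding prod_config[OF X] using w by (intro prod.cong) (auto simp: field_simps)
    also have "\<dots> = inverse w ^ N * (\<Prod>k<N. w - of_real (sl X ! k))"
      unfolding prod.distrib by (simp only: prod_constant card_lessThan)
    finally have 2: "(\<Prod>x\<in>X. 1 - of_real x * inverse w) = inverse w ^ N * (\<Prod>k<N. w - of_real (sl X ! k))" .
    have "N = i + (M - 1) + 2 + (K - 1 - i)" using N M i by simp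
    then have "inverse w ^ i * inverse w ^ (M - 1) * (1 / w\<^sup>2) / inverse w ^ N = w ^ (K - 1 - i)"
      using w by (simp add: power_add power_inverse divide_simps power2_eq_square)
    then have "poly p w / (\<Prod>k<N. w - of_real (sl X ! k)) =
        inverse w ^ i * inverse w ^ (M - 1) * (1 / w\<^sup>2) / inverse w ^ N *
        (\<Prod>l<M - 1. w - of_real (a * q ^ Suc l)) / (\<Prod>k<N. w - of_real (sl X ! k))"
      unfolding poly_p by simp
    then show ?thesis
      unfolding h_def 1 2 by (simp add: mult_ac)
  qed
  let ?g = "\<lambda>w. poly p w / (\<Prod>k<N. w - of_real (sl X ! k))"
  note rat = vline_integral_rational[OF inj_on_config[OF X] between(1) deg]
  have "vline_integrable c h \<longleftrightarrow> vline_integrable c ?g" by (rule vline_integrable_cong) (rule h)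
  then show "vline_integrable c h" using rat(1) by simp
  have "vline_integral c h = vline_integral c ?g" by (rule vline_integral_cong) (rule h)
  then have int: "vline_integral c h = 2 * of_real pi * \<i> *
      (\<Sum>k | k < N \<and> c < sl X ! k. poly p (of_real (sl X ! k)) / sl_deriv N X k)"
    using rat(2) by simp
  let ?t = "\<lambda>k. poly p (of_real (sl X ! k)) / sl_deriv N X k"
  have "(\<Sum>k<N. ?t k) = coeff p (N - 1)"
    using inj_on_config[OF X] deg by (intro sum_node_deriv) (auto simp: inj_on_def)
  then have tot: "(\<Sum>k<N. ?t k) = 0" using deg by (simp add: coeff_eq_0)
  let ?S = "\<lambda>x. 0 < a \<and> a \<le> x \<or> a < 0 \<and> x \<le> a"
  have "(\<Sum>k<N. of_real (sl X ! k) ^ (K - 1 - i) * of_real (delta_primitive q a M (sl X ! k)) / sl_deriv N X k) =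
      (\<Sum>k<N. of_real (a / qpoch q q (M - 1)) * (if ?S (sl X ! k) then ?t k else 0))"
  proof (rule sum.cong[OF refl])
    fix k
    show "of_real (sl X ! k) ^ (K - 1 - i) * of_real (delta_primitive q a M (sl X ! k)) / sl_deriv N X k =
        of_real (a / qpoch q q (M - 1)) * (if ?S (sl X ! k) then ?t k else 0)"
    proof (cases "?S (sl X ! k)")
      case True
      then have "delta_primitive q a M (sl X ! k) =
          a / qpoch q q (M - 1) * (\<Prod>l<M - 1. sl X ! k - a * q ^ Suc l)"
        using M by (simp add: delta_primitive_def)
      then have "complex_of_real (delta_primitive q a M (sl X ! k)) =
          of_real (a / qpoch q q (M - 1)) * (\<Prod>l<M - 1. of_real (sl X ! k) - of_real (a * q ^ Suc l))"
        by (simp only: of_real_mult of_real_prod of_real_diff)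
      then show ?thesis
        using True unfolding poly_p by (simp only: if_True) (simp add: mult_ac)
    next
      case False
      then have "delta_primitive q a M (sl X ! k) = 0"
        using M by (simp only: delta_primitive_def if_False) simp
      then show ?thesis using False by (simp only: if_False) simp
    qed
  qed
  also have "\<dots> = of_real (a / qpoch q q (M - 1)) * (\<Sum>k<N. if ?S (sl X ! k) then ?t k else 0)"
    by (rule sum_distrib_left[symmetric])
  also have "(\<Sum>k<N. if ?S (sl X ! k) then ?t k else 0) = (\<Sum>k | k < N \<and> ?S (sl X ! k). ?t k)"
    using sum.inter_filter[of "{..<N}" ?t "\<lambda>k. ?S (sl X ! k)"] by simp
  also have "of_real (a / qpoch q q (M - 1)) * \<dots> = of_real (\<bar>a\<bar> / qpoch q q (M - 1)) * (\<Sum>k | k < N \<and> c < sl X ! k. ?t k)"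
  proof (cases "0 < a")
    case True
    then have "{k. k < N \<and> ?S (sl X ! k)} = {k. k < N \<and> c < sl X ! k}"
      using between(2) by auto
    with True show ?thesis by simp
  next
    case False
    then have neg: "a < 0" using lattice_neq_0[OF a] by simp
    have "{k. k < N \<and> ?S (sl X ! k)} = {k. k < N \<and> sl X ! k < c}"
      using between(3) neg by auto
    moreover have "(\<Sum>k | k < N \<and> sl X ! k < c. ?t k) + (\<Sum>k | k < N \<and> c < sl X ! k. ?t k) = (\<Sum>k<N. ?t k)"
    proof -
      have "{k. k < N \<and> sl X ! k < c} \<union> {k. k < N \<and> c < sl X ! k} = {..<N}"
        using between(1) by (auto simp: neq_iff)
      moreover have "(\<Sum>k\<in>{k. k < N \<and> sl X ! k < c} \<union> {k. k < N \<and> c < sl X ! k}. ?t k) =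
          (\<Sum>k | k < N \<and> sl X ! k < c. ?t k) + (\<Sum>k | k < N \<and> c < sl X ! k. ?t k)"
        by (rule sum.union_disjoint) auto
      ultimately show ?thesis by (simp only:)
    qed
    ultimately have "(\<Sum>k | k < N \<and> ?S (sl X ! k). ?t k) = - (\<Sum>k | k < N \<and> c < sl X ! k. ?t k)"
      using tot by (simp add: add_eq_0_iff2)
    with neg show ?thesis by simp
  qed
  finally show "(\<Sum>k<N. of_real (sl X ! k) ^ (K - 1 - i) * of_real (delta_primitive q a M (sl X ! k)) / sl_deriv N X k) =
      of_real (\<bar>a\<bar> / qpoch q q (M - 1)) / (2 * of_real pi * \<i>) * vline_integral c h"
    unfolding int by simp
qed

text \<open>With \<open>t = inverse u\<close>, which is not real, the last primitive is a multiple
  of \<open>1 / (t - x)\<close>, and the sum over nodes is a partial fraction expansion read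
  backwards. Of the collected power \<open>t ^ (N - i)\<close>, the part \<open>t ^ N\<close> turns
  each \<open>1 / (t - x)\<close> into \<open>1 / (1 - x * u)\<close>.\<close>

lemma kernel_column:
  assumes X: "X \<in> cf N" and N: "N = M + K" and i: "i < K" and u: "u \<notin> \<real>"
  shows "(\<Sum>k<N. of_real (sl X ! k) ^ (K - 1 - i) * kernel_primitive (of_real q) u M M (of_real (sl X ! k)) / sl_deriv N X k) =
    u ^ i / of_real (qpoch q q M) * (\<Prod>x\<in>X. 1 / (1 - of_real x * u))"
proof -
  have u0: "u \<noteq> 0" using u by auto
  define t where "t = inverse u"
  have t0: "t \<noteq> 0" and ut: "u = inverse t" using u0 by (auto simp: t_def)
  have t_real: "t \<noteq> of_real x" for x
    using u by (metis Reals_inverse Reals_of_real ut)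
  have one: "1 / (1 - of_real x * u) = t / (t - of_real x)" for x
    using t_real[of x] t0 by (simp add: ut divide_simps)
  let ?Q = "of_real (qpoch q q M) :: complex"
  have "kernel_primitive (of_real q) u M M (of_real x) = t ^ M / ?Q * (1 / (1 - of_real x * u))" for x
    using t0 by (simp add: kernel_primitive_def qpoch_Suc of_real_qpoch ut power_inverse divide_inverse)
  then have "(\<Sum>k<N. of_real (sl X ! k) ^ (K - 1 - i) * kernel_primitive (of_real q) u M M (of_real (sl X ! k)) / sl_deriv N X k) =
      (\<Sum>k<N. t ^ Suc M / ?Q * (poly (monom 1 (K - 1 - i)) (of_real (sl X ! k)) / sl_deriv N X k / (t - of_real (sl X ! k))))"
    unfolding one by (simp add: poly_monom mult_ac)
  also have "\<dots> = t ^ Suc M / ?Q * (\<Sum>k<N. poly (monom 1 (K - 1 - i)) (of_real (sl X ! k)) / sl_deriv N X k / (t - of_real (sl X ! k)))"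
    by (rule sum_distrib_left[symmetric])
  also have "(\<Sum>k<N. poly (monom 1 (K - 1 - i)) (of_real (sl X ! k)) / sl_deriv N X k / (t - of_real (sl X ! k))) =
      poly (monom 1 (K - 1 - i)) t / (\<Prod>k<N. t - of_real (sl X ! k))"
    using inj_on_config[OF X] N i
    by (intro partial_fractions) (auto simp: inj_on_def degree_monom_eq t_real)
  also have "t ^ Suc M / ?Q * \<dots> = t ^ (Suc M + (K - 1 - i)) / ?Q / (\<Prod>k<N. t - of_real (sl X ! k))"
    unfolding power_add by (simp add: poly_monom)
  also have "Suc M + (K - 1 - i) = M + K - i" using i by simp
  also have "t ^ (M + K - i) = u ^ i * t ^ N"
    using i N t0 by (simp add: ut power_inverse power_diff divide_inverse mult.commute)
  also have "u ^ i * t ^ N / ?Q / (\<Prod>k<N. t - of_real (sl X ! k)) = u ^ i / ?Q * (\<Prod>k<N. t / (t - of_real (sl X ! k)))"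
    by (simp add: prod_dividef)
  finally show ?thesis unfolding prod_config[OF X] one .
qed

text \<open>Once the \<open>(q; q)\<close> are taken out of the power columns,
  \<open>det_powers_append\<close> splits off the Vandermonde of \<open>X\<close>, which cancels the
  denominator of \<open>det_ratio\<close>.\<close>

lemma det_ratio_lift_fun:
  fixes a :: "real list" and z :: "complex list"
  assumes X: "X \<in> cf N" and N: "N = M + K"
  defines "\<psi> \<equiv> \<lambda>j. lift_fun a z M M (M + j)"
  shows "det_ratio N (lift_fun a z M M) X = of_real (\<Prod>j<M. 1 / qpoch q q j) *
    (\<Sum>p | p permutes {0..<K}. signof p *
      (\<Prod>j<K. \<Sum>k<N. of_real (sl X ! k) ^ (K - 1 - p j) * \<psi> j (sl X ! k) / sl_deriv N X k))"
proof -
  define x where "x k = complex_of_real (sl X ! k)" for k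
  have inj: "inj_on x {..<N}"
    using inj_on_config[OF X] by (auto simp: inj_on_def x_def)
  let ?d = "\<lambda>j. if j < M then complex_of_real (1 / qpoch q q j) else 1"
  let ?S = "\<lambda>i j. \<Sum>k<N. x k ^ (K - 1 - i) * \<psi> j (sl X ! k) / sl_deriv N X k"
  have len: "length (sl X) = N" using config_list[OF X] by simp
  have "Determinant.det (mat N N (\<lambda>(i, j). lift_fun a z M M j (sl X ! i))) =
      Determinant.det (mat N N (\<lambda>(i, j). ?d j * (if j < M then x i ^ j else \<psi> (j - M) (sl X ! i))))"
    by (intro arg_cong[where f = Determinant.det] eq_matI) (auto simp: lift_fun_def \<psi>_def x_def)
  also have "\<dots> = (\<Prod>j<N. ?d j) * Determinant.det (mat N N (\<lambda>(i, j). if j < M then x i ^ j else \<psi> (j - M) (sl X ! i)))"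
    by (rule det_scale_columns)
  also have "(\<Prod>j<N. ?d j) = of_real (\<Prod>j<M. 1 / qpoch q q j)"
    by (simp add: N prod_lessThan_add)
  also have "Determinant.det (mat N N (\<lambda>(i, j). if j < M then x i ^ j else \<psi> (j - M) (sl X ! i))) =
      Determinant.det (mat N N (\<lambda>(i, j). x i ^ j)) * Determinant.det (mat K K (\<lambda>(i, j). ?S i j))"
    using det_powers_append[OF inj N, of "\<lambda>j k. \<psi> j (sl X ! k)"] by (simp add: x_def)
  also have "Determinant.det (mat N N (\<lambda>(i, j). x i ^ j)) = of_real \<bar>vandermonde (sl X)\<bar>"
    unfolding det_power_matrix abs_vandermonde_sorted[OF config_list(3)[OF X]] len x_def by simp
  \<comment> \<open>Transposed so that the permutation acts on the exponents, as in the expansion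
    under the integral.\<close>
  also have "Determinant.det (mat K K (\<lambda>(i, j). ?S i j)) = Determinant.det (mat K K (\<lambda>(j, i). ?S i j))"
    by (subst det_transpose[of _ K, symmetric])
      (auto intro!: arg_cong[where f = Determinant.det] eq_matI)
  also have "\<dots> = (\<Sum>p | p permutes {0..<K}. signof p * (\<Prod>j<K. ?S (p j) j))"
    by (simp add: det_mat_eq)
  finally show ?thesis
    using vandermonde_config_neq_0[OF X] by (simp add: det_ratio_def x_def)
qed

end

section \<open>Constants and the final comparison\<close>

context q_lattice
begin

text \<open>On the left are the factors of the links, of the power columns, of the \<open>m\<close>
  delta columns and of the \<open>n\<close> kernel columns. The product of \<open>(q; q)\<close>
  over the indices below \<open>N\<close> is split once at \<open>M\<close> and once at
  \<open>K\<close>; \<open>(q; q)\<close> of index \<open>M\<close> over that of index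
  \<open>M - 1\<close> is \<open>1 - q ^ M\<close>.\<close>

lemma link_constant:
  assumes "0 < M" "N = M + K" "K = m + n"
  shows "(\<Prod>l<M. qpoch q q (K + l)) * (\<Prod>j<M. 1 / qpoch q q j) * (1 / qpoch q q (M - 1)) ^ m * (1 / qpoch q q M) ^ n =
    (\<Prod>i=1..K. qpoch q q (N - i) / (qpoch q q (K - i) * qpoch q q M)) * (1 - q ^ M) ^ m"
proof -
  let ?f = "qpoch q q"
  have nz: "(\<Prod>l<k. ?f l) \<noteq> 0" for k
    using qpoch_neq_0 by simp
  have "(\<Prod>i=1..K. ?f (N - i) / (?f (K - i) * ?f M)) = (\<Prod>l<K. ?f (M + l) / (?f l * ?f M))"
    by (rule prod.reindex_bij_witness[of _ "\<lambda>l. K - l" "\<lambda>i. K - i"]) (auto simp: assms(2))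
  also have "\<dots> = (\<Prod>l<K. ?f (M + l)) / (\<Prod>l<K. ?f l) * (1 / ?f M) ^ K"
    by (simp add: prod_dividef prod.distrib power_one_over)
  also have "(\<Prod>l<K. ?f (M + l)) = (\<Prod>l<K. ?f l) * (\<Prod>l<M. ?f (K + l)) / (\<Prod>l<M. ?f l)"
  proof -
    have "(\<Prod>l<M. ?f l) * (\<Prod>l<K. ?f (M + l)) = (\<Prod>l<K. ?f l) * (\<Prod>l<M. ?f (K + l))"
      using prod_lessThan_add[of ?f M K] prod_lessThan_add[of ?f K M] by (simp add: add.commute)
    then show ?thesis using nz[of M] by (simp add: field_simps)
  qed
  finally have 1: "(\<Prod>i=1..K. ?f (N - i) / (?f (K - i) * ?f M)) =
      (\<Prod>l<M. ?f (K + l)) * (\<Prod>j<M. 1 / ?f j) * (1 / ?f M) ^ K"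
    using nz[of K] by (simp add: prod_dividef)
  obtain k where k: "M = Suc k" using \<open>0 < M\<close> by (cases M) auto
  have "1 - q ^ M \<noteq> 0" "?f M = ?f (M - 1) * (1 - q ^ M)"
    using qpoch_neq_0[of M] by (auto simp: k qpoch_Suc)
  then have 2: "1 / ?f (M - 1) = 1 / ?f M * (1 - q ^ M)"
    by simp
  have 3: "(1 / ?f M) ^ K = (1 / ?f M) ^ m * (1 / ?f M) ^ n"
    by (simp only: assms(3) power_add)
  show ?thesis
    unfolding 1 2 3 by (simp only: power_mult_distrib mult_ac)
qed

end

text \<open>The entries of \<open>c\<close> are the freely chosen abscissas of the contours. An open
  segment does not depend on the order of its endpoints, which accommodates both signs of
  \<open>a ! r\<close>.\<close>

theorem theorem3p8:
  fixes q zp zm :: real and N K m n :: nat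
    and a c :: "real list" and z :: "complex list" and X :: "real set"
  assumes "0 < q" "q < 1" "0 < zp" "zm < 0"
    and "K \<ge> 1" "K < N" "m \<le> K" "n = K - m"
    and "set a \<in> configs q zp zm m" "sorted_wrt (<) a"
    and "length z = n" "distinct z" "set z \<inter> \<real> = {}"
    and "X \<in> configs q zp zm N"
    and "length c = m" "\<And>r. r < m \<Longrightarrow> c ! r \<in> open_segment (a ! r) (a ! r * q)"
  shows
    "link_act q zp zm N K (f_AZ q (set a) z N K) X =
       complex_of_real (vandermonde a)
       * complex_of_real
           (\<Prod>i=1..K. qpoch q q (N - i) / (qpoch q q (K - i) * qpoch q q (N - K)))
       * (complex_of_real ((1 - q ^ (N - K)) ^ m * (\<Prod>r<m. \<bar>a ! r\<bar>)) / (2 * complex_of_real pi * \<i>) ^ m)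
       * (\<Prod>x\<in>X. \<Prod>s<n. 1 / (1 - complex_of_real x * inverse (z ! s)))
       * iter_vline_integral c (\<lambda>w.
           vandermonde (map inverse w)
           * (\<Prod>s<n. \<Prod>r<m. inverse (z ! s) - inverse (w ! r))
           * (\<Prod>r<m. qpoch (complex_of_real (a ! r) * inverse (w ! r) * complex_of_real q)
                        (complex_of_real q) (N - K - 1)
                      / (\<Prod>x\<in>X. 1 - complex_of_real x * inverse (w ! r)))
           * (\<Prod>r<m. 1 / (w ! r)\<^sup>2))"
proof -
  interpret q_lattice q zp zm
    by standard (use assms in auto)
  define M where "M = N - K"
  have M: "0 < M" "N = M + K" "N = K + M" and K: "K = m + n"
    using assms by (auto simp: M_def)
  have X: "X \<in> cf N" by fact
  have dist_a: "distinct a"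
    using assms(10) by (simp add: strict_sorted_iff)
  have len_a: "length a = m" and a_L: "set a \<subseteq> L"
    using assms(9) distinct_card[OF dist_a] by (auto simp: configs_def)
  define u where "u = map inverse z"
  have u: "length u = n" "distinct u" "\<And>s. s < n \<Longrightarrow> u ! s = inverse (z ! s)"
    using assms(11,12) by (auto simp: u_def distinct_map inj_on_def)
  have u_nonreal: "u ! s \<notin> \<real>" if "s < n" for s
  proof -
    have "z ! s \<notin> \<real>" using that assms(11,13) nth_mem[of s z] by blast
    then show ?thesis using u(3)[OF that] by (metis Reals_inverse inverse_inverse_eq)
  qed
  let ?P = "{p. p permutes {0..<K}}"
  define h where "h r i w = inverse w ^ i *
      (qpoch (of_real (a ! r) * inverse w * of_real q) (of_real q) (M - 1) /
        (\<Prod>x\<in>X. 1 - of_real x * inverse w)) * (1 / w\<^sup>2)" for r i and w :: complex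
  define I where "I r i = vline_integral (c ! r) (h r i)" for r i
  \<comment> \<open>Both sides are reduced to \<open>C * T\<close>: on the left \<open>T\<close>
    comes from the \<open>K\<close> by \<open>K\<close> determinant, on the right from the expansion
    of the Vandermonde factors under the integral.\<close>
  define T where "T = (\<Sum>p\<in>?P. signof p * (\<Prod>r<m. I r (p r)) * (\<Prod>s<n. (u ! s) ^ p (m + s)))"
  define C where "C = (-1) ^ (m * n) / vandermonde u * rev_sign K"
  define \<psi> where "\<psi> j = lift_fun a z M M (M + j)" for j
  define S where "S j i = (\<Sum>k<N. of_real (sl X ! k) ^ (K - 1 - i) * \<psi> j (sl X ! k) / sl_deriv N X k)" for j i
  have a_mem: "a ! r \<in> L" if "r < m" for r
    using that a_L len_a nth_mem[of r a] by blast
  note column = vline_integral_delta_column[OF X M(2,1) _ a_mem assms(16), folded h_def]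
  have int: "vline_integrable (c ! r) (h r i)" if "r < m" "i < K" for r i
    using column(1)[OF that(2,1,1)] by (simp add: h_def[abs_def])
  have p_less: "p i < K" if "p \<in> ?P" "i < K" for p i
    using that permutes_in_image[of p "{0..<K}" i] by simp

  have S_delta: "S r i = of_real (\<bar>a ! r\<bar> / qpoch q q (M - 1)) / (2 * of_real pi * \<i>) * I r i"
    if "r < m" "i < K" for r i
    using column(2)[OF that(2,1,1)] that len_a
    by (simp add: S_def \<psi>_def lift_fun_def I_def h_def[abs_def])
  have S_kernel: "S (m + s) i = (u ! s) ^ i / of_real (qpoch q q M) * (\<Prod>x\<in>X. 1 / (1 - of_real x * u ! s))"
    if "s < n" "i < K" for s i
    using kernel_column[OF X M(2) that(2) u_nonreal[OF that(1)]] that len_a u(3)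
    by (simp add: S_def \<psi>_def lift_fun_def)
  have "(\<Prod>j<K. S j (p j)) =
      (\<Prod>r<m. of_real (\<bar>a ! r\<bar> / qpoch q q (M - 1)) / (2 * of_real pi * \<i>)) *
      (\<Prod>s<n. (\<Prod>x\<in>X. 1 / (1 - of_real x * u ! s)) / of_real (qpoch q q M)) *
      ((\<Prod>r<m. I r (p r)) * (\<Prod>s<n. (u ! s) ^ p (m + s)))" if p: "p \<in> ?P" for p
  proof -
    have "(\<Prod>j<K. S j (p j)) = (\<Prod>r<m. S r (p r)) * (\<Prod>s<n. S (m + s) (p (m + s)))"
      unfolding K by (rule prod_lessThan_add)
    also have "(\<Prod>r<m. S r (p r)) =
        (\<Prod>r<m. of_real (\<bar>a ! r\<bar> / qpoch q q (M - 1)) / (2 * of_real pi * \<i>) * I r (p r))"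
      using p_less[OF p] K by (intro prod.cong refl S_delta) auto
    also have "(\<Prod>s<n. S (m + s) (p (m + s))) =
        (\<Prod>s<n. (u ! s) ^ p (m + s) * ((\<Prod>x\<in>X. 1 / (1 - of_real x * u ! s)) / of_real (qpoch q q M)))"
      using p_less[OF p] K S_kernel by (intro prod.cong refl) auto
    finally show ?thesis unfolding prod.distrib by (simp only: mult_ac)
  qed
  then have det: "(\<Sum>p\<in>?P. signof p * (\<Prod>j<K. S j (p j))) =
      (\<Prod>r<m. of_real (\<bar>a ! r\<bar> / qpoch q q (M - 1)) / (2 * of_real pi * \<i>)) *
      (\<Prod>s<n. (\<Prod>x\<in>X. 1 / (1 - of_real x * u ! s)) / of_real (qpoch q q M)) * T"
    unfolding T_def sum_distrib_left by (intro sum.cong) (auto simp: mult_ac)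

  have "link_act q zp zm N K (f_AZ q (set a) z N K) X =
      of_real (vandermonde a) * C * link_act q zp zm N K (det_ratio K (lift_fun a z M 0)) X"
  proof -
    have "f_AZ q (set a) z N K Y = of_real (vandermonde a) * C * det_ratio K (lift_fun a z M 0) Y" if "Y \<in> cf K" for Y
      using f_AZ_eq_det_ratio[OF dist_a _ assms(6) that, of z] len_a assms(11) K
      by (simp add: C_def u_def M_def)
    then have "link_act q zp zm N K (f_AZ q (set a) z N K) X =
        (\<Sum>\<^sub>\<infinity>Y\<in>cf K. of_real (vandermonde a) * C * (of_real (link q zp zm N K X Y) * det_ratio K (lift_fun a z M 0) Y))"
      unfolding link_act_def by (intro infsum_cong) simp
    then show ?thesis by (simp only: infsum_cmult_right' link_act_def)
  qed
  also have "link_act q zp zm N K (det_ratio K (lift_fun a z M 0)) X =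
      of_real (\<Prod>l<M. qpoch q q (K + l)) * det_ratio N (lift_fun a z M M) X"
    unfolding M(3)
  proof (rule link_act_det_ratio)
    show "q_primitive (lift_fun a z M k j) (lift_fun a z M (Suc k) (Suc j))" if "k < M" "j < K + k" for k j
      using q_primitive_lift_fun[OF a_L assms(13) _ that(1)] that len_a assms(11) K by simp
    show "lift_fun a z M (Suc k) 0 = (\<lambda>_. 1)" for k
      by (simp add: lift_fun_def)
  qed (use M X in auto)
  also have "det_ratio N (lift_fun a z M M) X =
      of_real (\<Prod>j<M. 1 / qpoch q q j) * (\<Sum>p\<in>?P. signof p * (\<Prod>j<K. S j (p j)))"
    using det_ratio_lift_fun[OF X M(2), of a z] by (simp add: S_def \<psi>_def)
  finally have lhs: "link_act q zp zm N K (f_AZ q (set a) z N K) X =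
      of_real (vandermonde a) * C * (of_real (\<Prod>l<M. qpoch q q (K + l)) * (of_real (\<Prod>j<M. 1 / qpoch q q j) *
      ((\<Prod>r<m. of_real (\<bar>a ! r\<bar> / qpoch q q (M - 1)) / (2 * of_real pi * \<i>)) *
      (\<Prod>s<n. (\<Prod>x\<in>X. 1 / (1 - of_real x * u ! s)) / of_real (qpoch q q M)) * T)))"
    unfolding det .

  \<comment> \<open>For each permutation the integrand is now a product of functions of single
    variables, and the iterated integral becomes a product of the \<open>I r i\<close>.\<close>
  have "iter_vline_integral c (\<lambda>w.
           vandermonde (map inverse w)
           * (\<Prod>s<n. \<Prod>r<m. inverse (z ! s) - inverse (w ! r))
           * (\<Prod>r<m. qpoch (complex_of_real (a ! r) * inverse (w ! r) * complex_of_real q)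
                        (complex_of_real q) (N - K - 1)
                      / (\<Prod>x\<in>X. 1 - complex_of_real x * inverse (w ! r)))
           * (\<Prod>r<m. 1 / (w ! r)\<^sup>2)) =
      iter_vline_integral c (\<lambda>w. \<Sum>p\<in>?P. (C * (signof p * (\<Prod>s<n. (u ! s) ^ p (m + s)))) *
        (\<Prod>r<length c. h r (p r) (w ! r)))"
  proof (rule iter_vline_integral_cong)
    fix w :: "complex list" assume "length w = length c"
    then have w: "length w = m" using assms(15) by simp
    let ?v = "map inverse w"
    have "(\<Prod>s<n. \<Prod>r<m. inverse (z ! s) - inverse (w ! r)) = (\<Prod>s<n. \<Prod>r<m. u ! s - ?v ! r)"
      using w u(3) by simp
    then have "vandermonde ?v * (\<Prod>s<n. \<Prod>r<m. inverse (z ! s) - inverse (w ! r)) =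
        C * (\<Sum>p\<in>?P. signof p * (\<Prod>r<m. (?v ! r) ^ p r) * (\<Prod>s<n. (u ! s) ^ p (m + s)))"
      using vandermonde_mult_cross_expansion[OF u(2) _ u(1) K, of ?v] w by (simp add: C_def)
    also have "\<dots> = (\<Sum>p\<in>?P. (C * (signof p * (\<Prod>s<n. (u ! s) ^ p (m + s)))) * (\<Prod>r<m. inverse (w ! r) ^ p r))"
      unfolding sum_distrib_left using w by (intro sum.cong) (auto simp: mult_ac)
    finally show "vandermonde ?v
           * (\<Prod>s<n. \<Prod>r<m. inverse (z ! s) - inverse (w ! r))
           * (\<Prod>r<m. qpoch (complex_of_real (a ! r) * inverse (w ! r) * complex_of_real q)
                        (complex_of_real q) (N - K - 1)
                      / (\<Prod>x\<in>X. 1 - complex_of_real x * inverse (w ! r)))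
           * (\<Prod>r<m. 1 / (w ! r)\<^sup>2) =
        (\<Sum>p\<in>?P. (C * (signof p * (\<Prod>s<n. (u ! s) ^ p (m + s)))) * (\<Prod>r<length c. h r (p r) (w ! r)))"
      unfolding h_def M_def prod.distrib assms(15) by (simp only: sum_distrib_right mult.assoc)
  qed
  also have "\<dots> = (\<Sum>p\<in>?P. (C * (signof p * (\<Prod>s<n. (u ! s) ^ p (m + s)))) *
      (\<Prod>r<length c. I r (p r)))"
    unfolding I_def
  proof (rule iter_vline_integral_sum_prod)
    show "vline_integrable (c ! r) (h r (p r))" if "p \<in> ?P" "r < length c" for p r
      using that p_less[OF that(1)] K assms(15) by (intro int) auto
  qed (simp add: finite_permutations)
  also have "\<dots> = C * T"
    unfolding T_def sum_distrib_left assms(15) by (intro sum.cong) (auto simp: mult_ac)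
  finally have rhs: "iter_vline_integral c (\<lambda>w.
           vandermonde (map inverse w)
           * (\<Prod>s<n. \<Prod>r<m. inverse (z ! s) - inverse (w ! r))
           * (\<Prod>r<m. qpoch (complex_of_real (a ! r) * inverse (w ! r) * complex_of_real q)
                        (complex_of_real q) (N - K - 1)
                      / (\<Prod>x\<in>X. 1 - complex_of_real x * inverse (w ! r)))
           * (\<Prod>r<m. 1 / (w ! r)\<^sup>2)) = C * T" .

  define G where "G = (\<Prod>s<n. \<Prod>x\<in>X. 1 / (1 - complex_of_real x * u ! s))"
  have G: "(\<Prod>x\<in>X. \<Prod>s<n. 1 / (1 - complex_of_real x * inverse (z ! s))) = G"
    unfolding G_def by (subst prod.swap) (use u(3) in simp)
  let ?a = "complex_of_real (\<Prod>r<m. \<bar>a ! r\<bar>)"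
  have 1: "(\<Prod>r<m. complex_of_real (\<bar>a ! r\<bar> / qpoch q q (M - 1)) / (2 * of_real pi * \<i>)) =
      ?a * of_real ((1 / qpoch q q (M - 1)) ^ m) / (2 * of_real pi * \<i>) ^ m"
    by (simp add: prod_dividef power_divide power_mult_distrib)
  have 2: "(\<Prod>s<n. (\<Prod>x\<in>X. 1 / (1 - complex_of_real x * u ! s)) / of_real (qpoch q q M)) =
      G * of_real ((1 / qpoch q q M) ^ n)"
    by (simp add: G_def prod_dividef power_divide prod.distrib)
  have "of_real (\<Prod>l<M. qpoch q q (K + l)) * (of_real (\<Prod>j<M. 1 / qpoch q q j) *
      (?a * of_real ((1 / qpoch q q (M - 1)) ^ m) / (2 * of_real pi * \<i>) ^ m *
      (G * of_real ((1 / qpoch q q M) ^ n)) * T)) =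
      complex_of_real ((\<Prod>l<M. qpoch q q (K + l)) * (\<Prod>j<M. 1 / qpoch q q j) *
        (1 / qpoch q q (M - 1)) ^ m * (1 / qpoch q q M) ^ n) *
      (?a / (2 * of_real pi * \<i>) ^ m) * G * T"
    by (simp only: of_real_mult times_divide_eq_left times_divide_eq_right mult_ac)
  also have "\<dots> = complex_of_real ((\<Prod>i=1..K. qpoch q q (N - i) / (qpoch q q (K - i) * qpoch q q M)) *
      (1 - q ^ M) ^ m) * (?a / (2 * of_real pi * \<i>) ^ m) * G * T"
    unfolding link_constant[OF M(1,2) K] ..
  finally have eq: "of_real (\<Prod>l<M. qpoch q q (K + l)) * (of_real (\<Prod>j<M. 1 / qpoch q q j) *
      (?a * of_real ((1 / qpoch q q (M - 1)) ^ m) / (2 * of_real pi * \<i>) ^ m *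
      (G * of_real ((1 / qpoch q q M) ^ n)) * T)) =
    complex_of_real ((\<Prod>i=1..K. qpoch q q (N - i) / (qpoch q q (K - i) * qpoch q q M)) *
      (1 - q ^ M) ^ m) * (?a / (2 * of_real pi * \<i>) ^ m) * G * T" .
  show ?thesis
    unfolding lhs rhs unfolding G 1 2 M_def[symmetric] eq
    by (simp only: of_real_mult times_divide_eq_left times_divide_eq_right mult_ac)
qed

end
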